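(* Let $d\ge 1$, $1\le p<\infty$, and let $\nu:\mathbb{R}^d\setminus\{0\}\to[0,\infty)$ be a measurable function with the following properties. (A) $\int_{\mathbb{R}^d}(1\wedge|h|^p)\,\nu(h)\,dh<\infty$, $\nu$ is radial (write $\nu(h)=\nu(|h|)$), and $\nu$ is almost decreasing: there is $0<\kappa\le 1$ such that $\kappa\,\nu(|x|)\le\nu(|y|)$ whenever $|x|\ge|y|$. (B) With $w$ the potential associated with $\nu$ (see context), the mapping $t\mapsto 1/w(1/t)$ is invertible from $[0,\infty)$ to $[0,\infty)$, and its inverse $\phi$ is a Young function; equivalently $w(t)=1/\phi^{-1}(1/t)$. (C) The function $\phi_p(t)=\phi(t^{1/p})$ is convex on $[0,\infty)$ (hence a Young function), and there is $\theta>0$ such that $$\phi\Big(\theta\,\frac{s}{t}\Big)\le\frac{\phi(s)}{\phi(t)}\qquad\text{for all } 0\le s\le t,\ t>0.$$ For $t\ge 2$ (with $t>2$ if $p=1$) define $C_p(t)=\frac{t^p-2}{t^p-1}$ and $\Theta_t=t\,\big[2\kappa^2C_p(t)\,\phi(\theta/t)\big]^{-1/p}$. Then $$\|u\|_{L^\phi(\mathbb{R}^d)}\le\Theta_t\Big(\int_{\mathbb{R}^d}\int_{\mathbb{R}^d}|u(x)-u(y)|^p\,\nu(x-y)\,dy\,dx\Big)^{1/p}\qquad\text{for all } u\in L^\phi(\mathbb{R}^d).$$ Accordingly, the embeddings $W^p_\nu(\mathbb{R}^d)\hookrightarrow L^\phi(\mathbb{R}^d)$ and $W^{1,p}(\mathbb{R}^d)\hookrightarrow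 L^\phi(\mathbb{R}^d)$ are continuous.
   Context: Notation: $a\wedge b=\min(a,b)$, $B(0,r)$ is the open ball of radius $r$ centered at $0$, $B^c(0,r)$ its complement, $|E|$ the Lebesgue measure of $E$, $c_d=|B(0,1)|$, $\eta(r)=(r/c_d)^{1/d}$ (so $|B(0,\eta(r))|=r$). The potential $w:[0,\infty)\to[0,\infty)$ associated with $\nu$ is $$w(r)=\Big(r\int_{B^c(0,\eta(r))}\nu(h)\,dh\Big)^{1/p}\ \ (r>0),\qquad w(0)=0.$$ The mapping $t\mapsto 1/w(1/t)$ is given the value $0$ at $t=0$. A Young function is a convex function $\phi:[0,\infty]\to[0,\infty]$ with $\phi(0)=0$, not identically $0$ and not identically $\infty$ on $(0,\infty)$. The Orlicz space $L^\phi(\mathbb{R}^d)$ consists of the measurable $u:\mathbb{R}^d\to\mathbb{R}$ with $\int_{\mathbb{R}^d}\phi(|u(x)|/\lambda)\,dx<\infty$ for some $\lambda>0$, with the Luxemburg norm $$\|u\|_{L^\phi(\mathbb{R}^d)}=\inf\Big\{\lambda>0:\int_{\mathbb{R}^d}\phi\big(|u(x)|/\lambda\big)\,dx\le 1\Big\}.$$ $W^p_\nu(\mathbb{R}^d)=\{u\in L^p(\mathbb{R}^d):|u|_{W^p_\nu(\mathbb{R}^d)}<\infty\}$, where $|u|^p_{W^p_\nu(\mathbb{R}^d)}=\int_{\mathbb{R}^d}\int_{\mathbb{R}^d}|u(x)-u(y)|^p\nu(x-y)\,dy\,dx$, with norm $(\|u\|^p_{L^p}+|u|^p_{W^p_\nu})^{1/p}$.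 $W^{1,p}(\mathbb{R}^d)$ is the classical Sobolev space. The right-hand side of the inequality may be $+\infty$. *)

theory Defs
  imports "HOL-Analysis.Analysis"
begin

(* x^a for x in [0,\<infinity>] and an exponent a > 0; the library has no powr on ennreal. *)
definition ennreal_powr :: "ennreal \<Rightarrow> real \<Rightarrow> ennreal" where
  "ennreal_powr x a = (if x = \<infinity> then \<infinity> else ennreal (enn2real x powr a))"


subsection \<open>The kernel and its potential\<close>

(* The kernel lives on the punctured space: the value nu 0 is unconstrained, and no integral
   below depends on it. *)
definition levy_kernel :: "real \<Rightarrow> ('a::euclidean_space \<Rightarrow> real) \<Rightarrow> bool" where
  "levy_kernel p \<nu> \<longleftrightarrow>
     \<nu> \<in> borel_measurable (lebesgue_on (- {0})) \<and>
     (\<forall>h. h \<noteq> 0 \<longrightarrow> 0 \<le> \<nu> h) \<and>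
     (\<integral>\<^sup>+h. ennreal (min 1 (norm h powr p) * \<nu> h) \<partial>lebesgue) < \<infinity>"

definition radial :: "('a::euclidean_space \<Rightarrow> real) \<Rightarrow> bool" where
  "radial \<nu> \<longleftrightarrow> (\<forall>x y. x \<noteq> 0 \<and> y \<noteq> 0 \<and> norm x = norm y \<longrightarrow> \<nu> x = \<nu> y)"

definition almost_decreasing :: "real \<Rightarrow> ('a::euclidean_space \<Rightarrow> real) \<Rightarrow> bool" where
  "almost_decreasing \<kappa> \<nu> \<longleftrightarrow>
     (\<forall>x y. x \<noteq> 0 \<and> y \<noteq> 0 \<and> norm y \<le> norm x \<longrightarrow> \<kappa> * \<nu> x \<le> \<nu> y)"

definition ball_radius :: "'a::euclidean_space itself \<Rightarrow> real \<Rightarrow> real" where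
  "ball_radius _ r = (r / measure lebesgue (ball (0::'a) 1)) powr (1 / DIM('a))"

(* For a Levy kernel the integral is finite when r > 0, so the Bochner integral is the
   intended one. *)
definition potential :: "real \<Rightarrow> ('a::euclidean_space \<Rightarrow> real) \<Rightarrow> real \<Rightarrow> real" where
  "potential p \<nu> r =
     (if r = 0 then 0
      else (r * (LINT h : - ball (0::'a) (ball_radius TYPE('a) r) | lebesgue. \<nu> h)) powr (1 / p))"

(* If w(1/t) = 0 for some t > 0, division by zero gives the value 0 = recip_potential p nu 0,
   so bijectivity on [0,\<infinity>) includes w(1/t) > 0 for all t > 0. *)
definition recip_potential :: "real \<Rightarrow> ('a::euclidean_space \<Rightarrow> real) \<Rightarrow> real \<Rightarrow> real" where
  "recip_potential p \<nu> t = (if t = 0 then 0 else 1 / potential p \<nu> (1 / t))"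


subsection \<open>Young functions and Orlicz spaces\<close>

(* Convexity on [0,\<infinity>] uses the convention 0 * \<infinity> = 0 of ennreal. *)
definition young_function :: "(ennreal \<Rightarrow> ennreal) \<Rightarrow> bool" where
  "young_function \<Phi> \<longleftrightarrow>
     (\<forall>x y. \<forall>a\<in>{0..1::real}.
        \<Phi> (ennreal a * x + ennreal (1 - a) * y) \<le> ennreal a * \<Phi> x + ennreal (1 - a) * \<Phi> y) \<and>
     \<Phi> 0 = 0 \<and>
     \<not> (\<forall>x. 0 < x \<and> x < \<infinity> \<longrightarrow> \<Phi> x = 0) \<and>
     \<not> (\<forall>x. 0 < x \<and> x < \<infinity> \<longrightarrow> \<Phi> x = \<infinity>)"

(* A function [0,\<infinity>) -> [0,\<infinity>) as a function on [0,\<infinity>], with value \<infinity> at \<infinity>. *)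
definition extend_infty :: "(real \<Rightarrow> real) \<Rightarrow> ennreal \<Rightarrow> ennreal" where
  "extend_infty \<phi> x = (if x = \<infinity> then \<infinity> else ennreal (\<phi> (enn2real x)))"

definition orlicz_modular ::
    "(ennreal \<Rightarrow> ennreal) \<Rightarrow> ('a::euclidean_space \<Rightarrow> real) \<Rightarrow> real \<Rightarrow> ennreal" where
  "orlicz_modular \<Phi> u l = (\<integral>\<^sup>+x. \<Phi> (ennreal (\<bar>u x\<bar> / l)) \<partial>lebesgue)"

definition orlicz_space :: "(ennreal \<Rightarrow> ennreal) \<Rightarrow> ('a::euclidean_space \<Rightarrow> real) set" where
  "orlicz_space \<Phi> =
     {u. u \<in> borel_measurable lebesgue \<and> (\<exists>l>0. orlicz_modular \<Phi> u l < \<infinity>)}"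

definition luxemburg_norm ::
    "(ennreal \<Rightarrow> ennreal) \<Rightarrow> ('a::euclidean_space \<Rightarrow> real) \<Rightarrow> ennreal" where
  "luxemburg_norm \<Phi> u = Inf {ennreal l | l. 0 < l \<and> orlicz_modular \<Phi> u l \<le> 1}"


subsection \<open>The nonlocal and the classical Sobolev space\<close>

(* The p-th power of the L^p norm. *)
definition lp_energy :: "real \<Rightarrow> ('a::euclidean_space \<Rightarrow> 'b::real_normed_vector) \<Rightarrow> ennreal" where
  "lp_energy p f = (\<integral>\<^sup>+x. ennreal (norm (f x) powr p) \<partial>lebesgue)"

definition lp_space :: "real \<Rightarrow> ('a::euclidean_space \<Rightarrow> 'b::real_normed_vector) set" where
  "lp_space p = {f. f \<in> borel_measurable lebesgue \<and> lp_energy p f < \<infinity>}"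

(* The p-th power of the seminorm of the nonlocal Sobolev space. *)
definition nonlocal_energy ::
    "real \<Rightarrow> ('a::euclidean_space \<Rightarrow> real) \<Rightarrow> ('a \<Rightarrow> real) \<Rightarrow> ennreal" where
  "nonlocal_energy p \<nu> u =
     (\<integral>\<^sup>+x. (\<integral>\<^sup>+y. ennreal (\<bar>u x - u y\<bar> powr p * \<nu> (x - y)) \<partial>lebesgue) \<partial>lebesgue)"

definition nonlocal_sobolev_space ::
    "real \<Rightarrow> ('a::euclidean_space \<Rightarrow> real) \<Rightarrow> ('a \<Rightarrow> real) set" where
  "nonlocal_sobolev_space p \<nu> = {u \<in> lp_space p. nonlocal_energy p \<nu> u < \<infinity>}"

definition nonlocal_sobolev_norm ::
    "real \<Rightarrow> ('a::euclidean_space \<Rightarrow> real) \<Rightarrow> ('a \<Rightarrow> real) \<Rightarrow> ennreal" where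
  "nonlocal_sobolev_norm p \<nu> u = ennreal_powr (lp_energy p u + nonlocal_energy p \<nu> u) (1 / p)"

(* C^k through partial derivatives: totally differentiable with all partial derivatives C^(k-1). *)
fun ck_function :: "nat \<Rightarrow> ('a::euclidean_space \<Rightarrow> real) \<Rightarrow> bool" where
  "ck_function 0 f \<longleftrightarrow> continuous_on UNIV f"
| "ck_function (Suc k) f \<longleftrightarrow>
     (\<forall>x. f differentiable (at x)) \<and>
     (\<forall>b\<in>Basis. ck_function k (\<lambda>x. frechet_derivative f (at x) b))"

definition test_function :: "('a::euclidean_space \<Rightarrow> real) \<Rightarrow> bool" where
  "test_function \<psi> \<longleftrightarrow> (\<forall>k. ck_function k \<psi>) \<and> compact (closure {x. \<psi> x \<noteq> 0})"

definition locally_integrable :: "('a::euclidean_space \<Rightarrow> 'b::euclidean_space) \<Rightarrow> bool" where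
  "locally_integrable f \<longleftrightarrow> (\<forall>K. compact K \<longrightarrow> set_integrable lebesgue K f)"

definition has_weak_gradient :: "('a::euclidean_space \<Rightarrow> real) \<Rightarrow> ('a \<Rightarrow> 'a) \<Rightarrow> bool" where
  "has_weak_gradient u g \<longleftrightarrow>
     locally_integrable u \<and> locally_integrable g \<and>
     (\<forall>\<psi>. test_function \<psi> \<longrightarrow> (\<forall>b\<in>Basis.
        (LINT x|lebesgue. u x * frechet_derivative \<psi> (at x) b) =
        - (LINT x|lebesgue. (g x \<bullet> b) * \<psi> x)))"

(* Weak gradients are unique up to null sets, so the choice does not affect the norm below. *)
definition weak_gradient :: "('a::euclidean_space \<Rightarrow> real) \<Rightarrow> ('a \<Rightarrow> 'a)" where
  "weak_gradient u = (SOME g. has_weak_gradient u g)"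

definition sobolev_space :: "real \<Rightarrow> ('a::euclidean_space \<Rightarrow> real) set" where
  "sobolev_space p = {u \<in> lp_space p. \<exists>g \<in> lp_space p. has_weak_gradient u g}"

definition sobolev_norm :: "real \<Rightarrow> ('a::euclidean_space \<Rightarrow> real) \<Rightarrow> ennreal" where
  "sobolev_norm p u = ennreal_powr (lp_energy p u + lp_energy p (weak_gradient u)) (1 / p)"

(* X is contained in Y and the (linear) inclusion is bounded. *)
definition continuously_embedded ::
    "'f set \<Rightarrow> ('f \<Rightarrow> ennreal) \<Rightarrow> 'f set \<Rightarrow> ('f \<Rightarrow> ennreal) \<Rightarrow> bool" where
  "continuously_embedded X normX Y normY \<longleftrightarrow>
     X \<subseteq> Y \<and> (\<exists>C::real. 0 < C \<and> (\<forall>u\<in>X. normY u \<le> ennreal C * normX u))"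


subsection \<open>The constants\<close>

definition C_const :: "real \<Rightarrow> real \<Rightarrow> real" where
  "C_const p t = (t powr p - 2) / (t powr p - 1)"

definition Theta_const :: "real \<Rightarrow> real \<Rightarrow> real \<Rightarrow> (real \<Rightarrow> real) \<Rightarrow> real \<Rightarrow> real" where
  "Theta_const p \<kappa> \<theta> \<phi> t =
     t * (2 * \<kappa>\<^sup>2 * C_const p t * \<phi> (\<theta> / t)) powr (- 1 / p)"

end

theory Submission
  imports Defs
begin

text \<open>
  Cut \<open>u\<close> at the levels \<open>t^k\<close> and let \<open>a k\<close> be the measure of \<open>{x. t^k < \<bar>u x\<bar>}\<close>.
  Superadditivity of \<open>s^p\<close> and \<open>t \<ge> 2\<close> bound \<open>\<bar>u x - u y\<bar>^p\<close> from below by the sum of \<open>t^(kp)\<close> over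
  the levels \<open>k\<close> with \<open>[t^k, t^(k+1)]\<close> between \<open>\<bar>u x\<bar>\<close> and \<open>\<bar>u y\<bar>\<close>. Rearranging a set into a ball
  costs a factor \<open>\<kappa>\<^sup>2\<close>, so the energy is at least \<open>2 \<kappa>\<^sup>2\<close> times the sum of
  \<open>t^(kp) a (k+1) g (a k) / a k\<close>, where \<open>g = w^p\<close>. The growth condition gives
  \<open>\<psi> (\<theta>^p g (a (k+1)) / g (a k)) \<le> a (k+1) / a k\<close> for \<open>\<psi> s = \<phi> (s^(1/p))\<close>. Bounding the convex \<open>\<psi>\<close>
  from below by its supporting line at \<open>(\<theta>/t)^p\<close> makes the error terms telescope, hence the energy
  is at least \<open>2 \<kappa>\<^sup>2 \<phi> (\<theta>/t)\<close> times \<open>X\<close>, the sum of \<open>x k = t^(kp) g (a k)\<close>. Finally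
  \<open>\<phi> (\<bar>u\<bar> / (t X^(1/p))) \<le> x k / (X a k)\<close> where \<open>t^k < \<bar>u\<bar> \<le> t^(k+1)\<close>, so the modular of \<open>u\<close> at
  \<open>t X^(1/p)\<close> is at most \<open>1\<close>.

  For the classical Sobolev space, testing against smooth bumps shows
  \<open>u (x + h) - u x = \<integral>\<^sub>0\<^sup>1 \<nabla>u (x + s h) \<bullet> h ds\<close> almost everywhere, which bounds the nonlocal energy
  by the Sobolev norm.
\<close>

subsection \<open>Level sums\<close>

text \<open>Why the supporting line sits at \<open>(\<theta>/t)^p\<close>: for
  \<open>a k > 0\<close> the ratio \<open>x (k+1) / x k\<close> is \<open>t^p\<close> times
  \<open>g (a (k+1)) / g (a k)\<close>, so the argument
  \<open>\<theta>^p g (a (k+1)) / g (a k)\<close> of \<open>\<psi>\<close> reaches that point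
  exactly when \<open>x (k+1) = x k\<close>, and the linear term, weighted by \<open>x k\<close>,
  becomes a constant multiple of \<open>x (k+1) - x k\<close>. The obstacle is the end at minus
  infinity: the telescoped term \<open>x (-N)\<close> has the wrong sign. An a priori bound on
  \<open>x k\<close> for \<open>k \<le> 0\<close> first makes the sum of the \<open>x k\<close>
  finite; then \<open>x (-N)\<close> tends to \<open>0\<close>, and the limit removes the boundary
  term with no loss in the constant. This bound and the finiteness of the \<open>a k\<close> are all
  that is used about the function space. For \<open>L^\<phi>\<close> the bound is a weak-type
  estimate valid at every level; for \<open>L^p\<close> it holds at the levels
  \<open>k \<le> 0\<close>, where \<open>a k\<close> grows as \<open>k\<close> decreases. The
  \<open>L^p\<close> version yields the embeddings, in which membership in \<open>L^\<phi>\<close>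
  is a conclusion.\<close>

lemma discrete_transport:
  fixes x s :: "int \<Rightarrow> real"
  assumes x0: "\<And>k. 0 \<le> x k" and xB: "\<And>k. k \<le> 0 \<Longrightarrow> x k \<le> B"
    and c: "0 < c" and m: "0 \<le> m"
    and s: "\<And>k. c * x k + m * (x (k + 1) - x k) \<le> s k"
    and S: "\<And>N::nat. (\<Sum>k\<in>{-int N..<int N}. s k) \<le> S"
  shows "c * (\<Sum>k\<in>{-int N..<int N}. x k) \<le> S"
proof -
  define X where "X N = (\<Sum>k\<in>{-int N..<int N}. x k)" for N :: nat
  have tel: "(\<Sum>k\<in>{-int N..<int N}. x (k + 1) - x k) = x (int N) - x (- int N)" for N
  proof (induction N)
    case (Suc N)
    have "{-int (Suc N)..<int (Suc N)} = insert (- 1 - int N) (insert (int N) {-int N..<int N})"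
      by auto
    then show ?case using Suc by (simp add: algebra_simps)
  qed simp
  \<comment> \<open>Of the two boundary terms, the one at \<open>int N\<close> has a favourable sign
    and is dropped; the one at \<open>- int N\<close> has to be sent to \<open>0\<close>.\<close>
  have step: "c * X N - m * x (- int N) \<le> S" for N
  proof -
    have "c * X N + m * (x (int N) - x (- int N)) = (\<Sum>k\<in>{-int N..<int N}. c * x k + m * (x (k + 1) - x k))"
      unfolding X_def tel[symmetric] by (simp add: sum.distrib sum_distrib_left)
    also have "\<dots> \<le> (\<Sum>k\<in>{-int N..<int N}. s k)" by (intro sum_mono s)
    also have "\<dots> \<le> S" by (rule S)
    finally show ?thesis using mult_nonneg_nonneg[OF m x0[of "int N"]] by (simp add: algebra_simps)
  qed
  have XS: "X (Suc N) = X N + x (int N) + x (- 1 - int N)" for N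
  proof -
    have "{-int (Suc N)..<int (Suc N)} = insert (- 1 - int N) (insert (int N) {-int N..<int N})"
      by auto
    then show ?thesis unfolding X_def by simp
  qed
  have mono: "incseq X" unfolding incseq_Suc_iff XS using x0 by (simp add: add_nonneg_nonneg add.assoc)
  have bdd: "X N \<le> (S + m * B) / c" for N
  proof -
    have "m * x (- int N) \<le> m * B" using xB m by (intro mult_left_mono) auto
    then show ?thesis using step[of N] c by (simp add: field_simps)
  qed
  obtain L where L: "X \<longlonglongrightarrow> L"
    using incseq_convergent[OF mono, of "(S + m * B) / c"] bdd by blast
  \<comment> \<open>\<open>B\<close> has served to make \<open>X\<close> converge. The increments of
    \<open>X\<close> dominate \<open>x (- int (Suc N))\<close>, so the boundary term vanishes in the
    limit and \<open>B\<close> leaves no trace in the conclusion.\<close>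
  have diff: "(\<lambda>N. X (Suc N) - X N) \<longlonglongrightarrow> 0"
    using tendsto_diff[OF LIMSEQ_Suc[OF L] L] by simp
  have "(\<lambda>N. x (- int (Suc N))) \<longlonglongrightarrow> 0"
  proof (rule tendsto_sandwich[OF _ _ tendsto_const diff])
    show "\<forall>\<^sub>F N in sequentially. x (- int (Suc N)) \<le> X (Suc N) - X N"
      using x0 by (simp add: XS algebra_simps)
  qed (use x0 in auto)
  then have "(\<lambda>N. x (- int N)) \<longlonglongrightarrow> 0" by (rule LIMSEQ_imp_Suc)
  then have "(\<lambda>N. c * X N - m * x (- int N)) \<longlonglongrightarrow> c * L - m * 0"
    by (intro tendsto_intros L)
  then have "c * L \<le> S" using step by (intro LIMSEQ_le_const2) auto
  moreover have "X N \<le> L" using incseq_le[OF mono L] .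
  ultimately show ?thesis using mult_left_mono[of "X N" L c] c unfolding X_def by linarith
qed

text \<open>Split off one factor, \<open>f k * f k powr (p - 1)\<close>, and enlarge the second
  factor to the power of the whole sum, which is monotone because \<open>p \<ge> 1\<close>.\<close>

lemma sum_powr_le_powr_sum:
  fixes f :: "'b \<Rightarrow> real"
  assumes "finite K" "\<And>k. k \<in> K \<Longrightarrow> 0 \<le> f k" "1 \<le> p"
  shows "(\<Sum>k\<in>K. f k powr p) \<le> (\<Sum>k\<in>K. f k) powr p"
proof -
  have *: "y powr p = y * y powr (p - 1)" if "0 \<le> y" for y :: real
    using that by (cases "y = 0") (auto simp: powr_diff)
  have "f k powr p \<le> f k * (\<Sum>k\<in>K. f k) powr (p - 1)" if "k \<in> K" for k
    unfolding *[OF assms(2)[OF that]]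
    using assms that by (intro mult_left_mono powr_mono2 member_le_sum) auto
  then have "(\<Sum>k\<in>K. f k powr p) \<le> (\<Sum>k\<in>K. f k * (\<Sum>k\<in>K. f k) powr (p - 1))"
    by (rule sum_mono)
  also have "\<dots> = (\<Sum>k\<in>K. f k) powr p"
    by (subst *[OF sum_nonneg]) (auto simp: assms sum_distrib_right)
  finally show ?thesis .
qed

section \<open>Levels in geometric progression and jumps across them\<close>

definition level :: "real \<Rightarrow> int \<Rightarrow> real" where
  "level t k = t powr (real_of_int k)"

lemma level_pos [simp]: "0 < t \<Longrightarrow> 0 < level t k"
  by (simp add: level_def)

lemma level_Suc: "0 < t \<Longrightarrow> level t (k + 1) = t * level t k"
  by (simp add: level_def powr_add)

lemma level_mono: "1 \<le> t \<Longrightarrow> i \<le> j \<Longrightarrow> level t i \<le> level t j"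
  by (simp add: level_def powr_mono)

lemma exists_level_bracket:
  assumes "1 < t" "0 < (y::real)"
  shows "\<exists>k. level t k < y \<and> y \<le> level t (k + 1)"
proof -
  \<comment> \<open>The bracket is open on the left and closed on the right, hence the ceiling minus
    one and not the floor.\<close>
  define k where "k = \<lceil>log t y\<rceil> - 1"
  have "real_of_int k < log t y" "log t y \<le> real_of_int (k + 1)"
    unfolding k_def by linarith+
  then show ?thesis
    using assms unfolding level_def by (intro exI[of _ k]) (auto simp: less_log_iff log_le_iff)
qed

text \<open>For \<open>t \<ge> 2\<close> each level is at most the gap to the next one, and gaps
  telescope. \<open>K\<close> may have holes: it is filled up to \<open>{Min K..Max K}\<close>,
  whose outermost levels still lie between \<open>v\<close> and \<open>u\<close>.\<close>

lemma gap_sum_le: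
  assumes t: "2 \<le> t" and K: "finite K" and uv: "v \<le> u"
    and sub: "\<And>k. k \<in> K \<Longrightarrow> v \<le> level t k \<and> level t (k + 1) < u"
  shows "(\<Sum>k\<in>K. level t k) \<le> u - v"
proof (cases "K = {}")
  case False
  define i j where "i = Min K" and "j = Max K"
  have ij: "i \<in> K" "j \<in> K" "K \<subseteq> {i..j}" using False K unfolding i_def j_def by auto
  then have "i \<le> j" by auto
  have "(\<Sum>k\<in>K. level t k) \<le> (\<Sum>k\<in>{i..j}. level t k)"
    using t ij by (intro sum_mono2) (auto intro: less_imp_le)
  also have "\<dots> \<le> (\<Sum>k\<in>{i..j}. level t (k + 1) - level t k)"
  proof (rule sum_mono)
    fix k
    have "2 * level t k \<le> t * level t k" using t by (intro mult_right_mono) (auto intro: less_imp_le)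
    then show "level t k \<le> level t (k + 1) - level t k"
      using t by (simp add: level_Suc)
  qed
  also have "\<dots> = level t (j + 1) - level t i"
    using \<open>i \<le> j\<close>
  proof (induction j rule: int_ge_induct)
    case (step j)
    have "{i..j + 1} = insert (j + 1) {i..j}" using step by auto
    then show ?case using step by simp
  qed simp
  also have "\<dots> \<le> u - v" using sub[OF ij(1)] sub[OF ij(2)] by linarith
  finally show ?thesis .
qed (use uv in auto)

text \<open>At each level at most one of the two products is nonzero; which one depends on whether
  \<open>\<bar>u\<bar>\<close> or \<open>\<bar>v\<bar>\<close> is larger. The levels whose gap is
  crossed add up to at most \<open>\<bar>u - v\<bar>\<close>, and superadditivity distributes the
  exponent over them. Asking for a whole gap to be crossed is what later pairs
  \<open>a (k + 1)\<close> with the tail at \<open>a k\<close>.\<close>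

lemma level_jump_sum_le:
  fixes u v :: real
  assumes t: "2 \<le> t" and p: "1 \<le> p" and K: "finite K"
  shows "(\<Sum>k\<in>K. level t k powr p *
      (indicator {z. level t (k + 1) < \<bar>z\<bar>} u * indicator {z. \<bar>z\<bar> \<le> level t k} v
       + indicator {z. \<bar>z\<bar> \<le> level t k} u * indicator {z. level t (k + 1) < \<bar>z\<bar>} v)) \<le> \<bar>u - v\<bar> powr p"
proof -
  have main: "(\<Sum>k\<in>K. level t k powr p *
      (indicator {z. level t (k + 1) < \<bar>z\<bar>} u * indicator {z. \<bar>z\<bar> \<le> level t k} v
       + indicator {z. \<bar>z\<bar> \<le> level t k} u * indicator {z. level t (k + 1) < \<bar>z\<bar>} v)) \<le> \<bar>u - v\<bar> powr p"
    if uv: "\<bar>v\<bar> \<le> \<bar>u\<bar>" for u v :: real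
  proof -
    define K' where "K' = {k\<in>K. \<bar>v\<bar> \<le> level t k \<and> level t (k + 1) < \<bar>u\<bar>}"
    have eq: "level t k powr p *
      (indicator {z. level t (k + 1) < \<bar>z\<bar>} u * indicator {z. \<bar>z\<bar> \<le> level t k} v
       + indicator {z. \<bar>z\<bar> \<le> level t k} u * indicator {z. level t (k + 1) < \<bar>z\<bar>} v)
       = (if k \<in> K' then level t k powr p else 0)" if "k \<in> K" for k
      using that uv level_mono[of t k "k+1"] t unfolding K'_def by (auto simp: indicator_def)
    have "(\<Sum>k\<in>K. if k \<in> K' then level t k powr p else 0) = (\<Sum>k\<in>K'. level t k powr p)"
      using K by (subst sum.If_cases) (auto intro!: sum.cong simp: K'_def)
    also have "\<dots> \<le> (\<Sum>k\<in>K'. level t k) powr p"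
      using t p K by (intro sum_powr_le_powr_sum) (auto simp: K'_def intro: less_imp_le)
    also have "\<dots> \<le> (\<bar>u\<bar> - \<bar>v\<bar>) powr p"
      using t p K uv by (intro powr_mono2 gap_sum_le sum_nonneg) (auto simp: K'_def intro: less_imp_le)
    also have "\<dots> \<le> \<bar>u - v\<bar> powr p" using p uv by (intro powr_mono2) auto
    finally show ?thesis using eq by simp
  qed
  show ?thesis
  proof (cases "\<bar>v\<bar> \<le> \<bar>u\<bar>")
    case False
    then show ?thesis using main[of u v]
      by (simp add: abs_minus_commute[of u v] mult.commute add.commute)
  qed (rule main)
qed

subsection \<open>Reflections and translations\<close>

lemma lborel_distr_reflect:
  fixes t :: "'a::euclidean_space"
  shows "distr lborel borel (\<lambda>x. t - x) = lborel"
  by (subst (2) lborel_affine[of "- 1" t]) (auto simp: density_1)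

lemma nn_integral_lborel_translate:
  fixes f :: "'a::euclidean_space \<Rightarrow> ennreal"
  assumes [measurable]: "f \<in> borel_measurable borel"
  shows "(\<integral>\<^sup>+x. f (t + x) \<partial>lborel) = (\<integral>\<^sup>+x. f x \<partial>lborel)"
  by (subst (2) lborel_distr_plus[of t, symmetric]) (simp add: nn_integral_distr)

lemma nn_integral_lborel_reflect:
  fixes f :: "'a::euclidean_space \<Rightarrow> ennreal"
  assumes [measurable]: "f \<in> borel_measurable borel"
  shows "(\<integral>\<^sup>+x. f (t - x) \<partial>lborel) = (\<integral>\<^sup>+x. f x \<partial>lborel)"
  by (subst (2) lborel_distr_reflect[of t, symmetric]) (simp add: nn_integral_distr)

lemma AE_lborel_reflect:
  fixes t :: "'a::euclidean_space"
  assumes "AE x in lborel. P x"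
  shows "AE x in lborel. P (t - x)"
proof (rule AE_distrD[of "\<lambda>x. t - x" lborel borel])
  show "AE x in distr lborel borel (\<lambda>x. t - x). P x" unfolding lborel_distr_reflect by (rule assms)
qed simp

subsection \<open>The tail of the kernel\<close>

text \<open>Indexed by the volume of the excluded ball instead of its radius, so that it can be
  evaluated at measures of level sets, and the p-th power of the potential at \<open>r > 0\<close>
  is \<open>r * kernel_tail \<nu> r\<close>.\<close>

definition kernel_tail :: "('a::euclidean_space \<Rightarrow> real) \<Rightarrow> real \<Rightarrow> real" where
  "kernel_tail \<nu> r = (LINT h : - ball (0::'a) (ball_radius TYPE('a) r) | lebesgue. \<nu> h)"

lemma ball_radius_pos: "0 < r \<Longrightarrow> 0 < ball_radius TYPE('a::euclidean_space) r"
  using content_ball_pos[of 1 "0::'a"] by (simp add: ball_radius_def)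

lemma ball_radius_mono: "0 \<le> r \<Longrightarrow> r \<le> s \<Longrightarrow> ball_radius TYPE('a::euclidean_space) r \<le> ball_radius TYPE('a) s"
  using content_ball_pos[of 1 "0::'a"]
  by (auto simp: ball_radius_def intro!: powr_mono2 divide_right_mono)

lemma emeasure_ball_radius:
  assumes "0 < r"
  shows "emeasure lborel (ball (0::'a::euclidean_space) (ball_radius TYPE('a) r)) = ennreal r"
proof -
  let ?c = "measure lborel (ball (0::'a) 1)"
  have c: "0 < ?c" using content_ball_pos[of 1 "0::'a"] by simp
  have "measure lborel (ball (0::'a) (ball_radius TYPE('a) r)) = ball_radius TYPE('a) r ^ DIM('a) * measure lborel (ball (0::'a) 1)"
    using ball_radius_pos[OF assms, where 'a='a] by (intro content_ball_conv_unit_ball) simp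
  also have "ball_radius TYPE('a) r ^ DIM('a) = r / ?c"
    using c assms by (simp add: ball_radius_def powr_powr flip: powr_realpow)
  finally have "measure lborel (ball (0::'a) (ball_radius TYPE('a) r)) = r" using c by simp
  moreover have "emeasure lborel (ball (0::'a) (ball_radius TYPE('a) r)) \<noteq> top"
    using emeasure_bounded_finite[of "ball (0::'a) (ball_radius TYPE('a) r)"] by (simp add: less_top)
  ultimately show ?thesis by (simp add: emeasure_eq_ennreal_measure)
qed

lemma levy_kernel_measurable:
  assumes "levy_kernel p \<nu>"
  shows "(\<lambda>h. indicator (- {0}) h * \<nu> h) \<in> borel_measurable lebesgue"
  using assms unfolding levy_kernel_def
  by (subst (asm) borel_measurable_restrict_space_iff) auto

lemma levy_kernel_tail_finite:
  fixes \<nu> :: "'a::euclidean_space \<Rightarrow> real"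
  assumes levy: "levy_kernel p \<nu>" and p: "1 \<le> p" and R: "0 < R"
  shows "(\<integral>\<^sup>+h. ennreal (\<nu> h) * indicator (- ball 0 R) h \<partial>lebesgue) < \<infinity>"
proof -
  define c where "c = min 1 (R powr p)"
  have c: "0 < c" using R by (simp add: c_def)
  \<comment> \<open>The weight is \<open>0\<close> at the origin, so cutting \<open>\<nu>\<close>
    off there does not change the product.\<close>
  have m: "(\<lambda>h. min 1 (norm h powr p) * \<nu> h) \<in> borel_measurable lebesgue"
  proof -
    have "(\<lambda>h. min 1 (norm h powr p)) \<in> borel_measurable (lebesgue :: 'a measure)"
      by (rule measurable_completion) simp
    from borel_measurable_times[OF this levy_kernel_measurable[OF levy]]
    show ?thesis by (rule measurable_cong[THEN iffD1, rotated]) (auto simp: indicator_def)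
  qed
  have "(\<integral>\<^sup>+h. ennreal (\<nu> h) * indicator (- ball 0 R) h \<partial>lebesgue)
      \<le> (\<integral>\<^sup>+h. ennreal (1 / c) * ennreal (min 1 (norm h powr p) * \<nu> h) \<partial>lebesgue)"
  proof (intro nn_integral_mono)
    fix h :: 'a
    show "ennreal (\<nu> h) * indicator (- ball 0 R) h \<le> ennreal (1 / c) * ennreal (min 1 (norm h powr p) * \<nu> h)"
    proof (cases "h \<in> ball 0 R")
      case False
      then have h: "h \<noteq> 0" "R \<le> norm h" using R by auto
      then have nu: "0 \<le> \<nu> h" using levy by (auto simp: levy_kernel_def)
      have "R powr p \<le> norm h powr p" using h R p by (intro powr_mono2) auto
      then have "c \<le> min 1 (norm h powr p)" by (auto simp: c_def)
      then have "\<nu> h \<le> 1 / c * (min 1 (norm h powr p) * \<nu> h)"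
        using c nu mult_right_mono[of c "min 1 (norm h powr p)" "\<nu> h"] by (simp add: field_simps)
      then show ?thesis using False c nu by (simp add: ennreal_mult'[symmetric] ennreal_leI)
    qed simp
  qed
  also have "\<dots> = ennreal (1 / c) * (\<integral>\<^sup>+h. ennreal (min 1 (norm h powr p) * \<nu> h) \<partial>lebesgue)"
    using m by (intro nn_integral_cmult) auto
  also have "\<dots> < \<infinity>"
    using levy by (auto simp: levy_kernel_def ennreal_mult_less_top)
  finally show ?thesis .
qed

lemma ennreal_kernel_tail:
  fixes \<nu> :: "'a::euclidean_space \<Rightarrow> real"
  assumes levy: "levy_kernel p \<nu>" and p: "1 \<le> p" and r: "0 < r"
  shows "ennreal (kernel_tail \<nu> r) =
    (\<integral>\<^sup>+h. ennreal (\<nu> h) * indicator (- ball 0 (ball_radius TYPE('a) r)) h \<partial>lebesgue)"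
    and "0 \<le> kernel_tail \<nu> r"
proof -
  let ?B = "- ball 0 (ball_radius TYPE('a) r) :: 'a set"
  have R: "0 < ball_radius TYPE('a) r" using r by (rule ball_radius_pos)
  have nn: "0 \<le> indicator ?B h *\<^sub>R \<nu> h" for h
    using R levy by (cases "h = 0") (auto simp: levy_kernel_def indicator_def)
  have eq: "ennreal (indicator ?B h *\<^sub>R \<nu> h) = ennreal (\<nu> h) * indicator ?B h" for h
    by (auto simp: indicator_def)
  have m: "(\<lambda>h. indicator ?B h *\<^sub>R \<nu> h) \<in> borel_measurable lebesgue"
  proof -
    have "(\<lambda>h. indicator ?B h) \<in> borel_measurable (lebesgue :: 'a measure)"
      by (rule measurable_completion) simp
    from borel_measurable_times[OF this levy_kernel_measurable[OF levy]]
    show ?thesis by (rule measurable_cong[THEN iffD1, rotated]) (use R in \<open>auto simp: indicator_def\<close>)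
  qed
  have int: "integrable lebesgue (\<lambda>h. indicator ?B h *\<^sub>R \<nu> h)"
    using levy_kernel_tail_finite[OF levy p R] unfolding eq[symmetric]
    by (intro integrableI_nonneg[OF m] AE_I2 nn)
  show "ennreal (kernel_tail \<nu> r) = (\<integral>\<^sup>+h. ennreal (\<nu> h) * indicator ?B h \<partial>lebesgue)"
    unfolding kernel_tail_def set_lebesgue_integral_def eq[symmetric]
    using nn by (intro nn_integral_eq_integral[symmetric] int) auto
  show "0 \<le> kernel_tail \<nu> r"
    unfolding kernel_tail_def set_lebesgue_integral_def using nn by (intro integral_nonneg_AE) auto
qed

lemma kernel_tail_antimono:
  fixes \<nu> :: "'a::euclidean_space \<Rightarrow> real"
  assumes levy: "levy_kernel p \<nu>" and p: "1 \<le> p" and r: "0 < r" "r \<le> s"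
  shows "kernel_tail \<nu> s \<le> kernel_tail \<nu> r"
proof -
  have sub: "- ball 0 (ball_radius TYPE('a) s) \<subseteq> (- ball 0 (ball_radius TYPE('a) r) :: 'a set)"
    using ball_radius_mono[of r s, where 'a='a] r by auto
  have "ennreal (kernel_tail \<nu> s) \<le> ennreal (kernel_tail \<nu> r)"
    using r sub by (subst (1 2) ennreal_kernel_tail[OF levy p])
      (auto intro!: nn_integral_mono mult_left_mono simp: indicator_def)
  then show ?thesis using ennreal_kernel_tail(2)[OF levy p] r by simp
qed

text \<open>The energy integrates \<open>\<nu> (x - y)\<close> over a product. A Borel
  representative stays measurable under subtraction, so that Fubini and changes of variables apply;
  the value of \<open>\<nu>\<close> at the origin disappears in the null set.\<close>

lemma levy_kernel_borel_version:
  fixes \<nu> :: "'a::euclidean_space \<Rightarrow> real"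
  assumes levy: "levy_kernel p \<nu>"
  obtains f :: "'a \<Rightarrow> ennreal" where "f \<in> borel_measurable borel" "AE h in lborel. f h = ennreal (\<nu> h)"
proof -
  have "(\<lambda>h. ennreal (indicator (- {0}) h * \<nu> h)) \<in> borel_measurable lebesgue"
    using levy_kernel_measurable[OF levy] by simp
  from completion_ex_borel_measurable[OF this] obtain f
    where f: "f \<in> borel_measurable lborel"
      "AE h in lborel. ennreal (indicator (- {0}) h * \<nu> h) = f h" by auto
  have "AE h in lborel. h \<noteq> (0::'a)" by (simp add: AE_lborel_singleton)
  with f(2) have "AE h in lborel. f h = ennreal (\<nu> h)"
    by eventually_elim auto
  with f(1) show ?thesis by (intro that) auto
qed

(* Exchanging the part of E outside the ball for the part of the ball outside E costs kappa twice,
   once on each side of the value of nu on the sphere. *)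
lemma kernel_rearrange:
  fixes \<nu> :: "'a::euclidean_space \<Rightarrow> real"
  assumes levy: "levy_kernel p \<nu>" and dec: "almost_decreasing \<kappa> \<nu>" and kappa: "0 < \<kappa>" "\<kappa> \<le> 1"
    and f[measurable]: "f \<in> borel_measurable borel" and fnu: "AE h in lborel. f h = ennreal (\<nu> h)"
    and E[measurable]: "E \<in> sets borel" and R: "0 < R" and EB: "emeasure lborel E = emeasure lborel (ball (0::'a) R)"
  shows "ennreal (\<kappa>\<^sup>2) * (\<integral>\<^sup>+h. f h * indicator (- ball 0 R) h \<partial>lborel) \<le> (\<integral>\<^sup>+h. f h * indicator (- E) h \<partial>lborel)"
proof -
  define B where "B = ball (0::'a) R"
  have [measurable]: "B \<in> sets borel" by (simp add: B_def)
  obtain h0 :: 'a where h0: "norm h0 = R" using vector_choose_size[of R] R by auto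
  define c where "c = ennreal (\<nu> h0)"
  have h00: "h0 \<noteq> 0" using h0 R by auto
  have K: "ennreal (\<kappa>\<^sup>2) = ennreal \<kappa> * ennreal \<kappa>"
    using kappa by (simp add: power2_eq_square ennreal_mult)
  have ne: "AE h in lborel. h \<noteq> (0::'a)" by (simp add: AE_lborel_singleton)
  have in_ball: "AE h in lborel. h \<in> B \<longrightarrow> ennreal \<kappa> * c \<le> f h"
    using fnu ne
  proof eventually_elim
    case (elim h)
    have "ennreal \<kappa> * c \<le> ennreal (\<nu> h)" if "h \<in> B"
    proof -
      have "\<kappa> * \<nu> h0 \<le> \<nu> h" using dec that elim h00 h0 unfolding almost_decreasing_def B_def by auto
      then show ?thesis using kappa by (simp add: c_def ennreal_mult'[symmetric] ennreal_leI)
    qed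
    with elim show ?case by simp
  qed
  have out_ball: "AE h in lborel. h \<notin> B \<longrightarrow> ennreal \<kappa> * f h \<le> c"
    using fnu ne
  proof eventually_elim
    case (elim h)
    have "ennreal \<kappa> * ennreal (\<nu> h) \<le> c" if "h \<notin> B"
    proof -
      have "\<kappa> * \<nu> h \<le> \<nu> h0" using dec that elim h00 h0 unfolding almost_decreasing_def B_def by auto
      then show ?thesis using kappa by (simp add: c_def ennreal_mult'[symmetric] ennreal_leI)
    qed
    with elim show ?case by simp
  qed
  have Bfin: "emeasure lborel B \<noteq> \<infinity>"
    using emeasure_bounded_finite[of B] by (simp add: B_def less_top)
  \<comment> \<open>Equal volumes minus the common part; the cancellation needs the intersection to
    have finite measure, which the ball provides.\<close>
  have meq: "emeasure lborel (B - E) = emeasure lborel (E - B)"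
  proof -
    have 1: "emeasure lborel (B \<inter> E) + emeasure lborel (B - E) = emeasure lborel B"
      by (subst plus_emeasure) (auto intro!: arg_cong[where f="emeasure lborel"])
    have 2: "emeasure lborel (B \<inter> E) + emeasure lborel (E - B) = emeasure lborel E"
      by (subst plus_emeasure) (auto intro!: arg_cong[where f="emeasure lborel"])
    have "emeasure lborel (B \<inter> E) \<noteq> \<infinity>"
      using Bfin emeasure_mono[of "B \<inter> E" B lborel] by (auto simp: top_unique)
    moreover have "emeasure lborel (B \<inter> E) + emeasure lborel (B - E) = emeasure lborel (B \<inter> E) + emeasure lborel (E - B)"
      using 1 2 EB by (simp add: B_def)
    ultimately show ?thesis by (simp add: ennreal_add_left_cancel)
  qed
  have "ennreal (\<kappa>\<^sup>2) * (\<integral>\<^sup>+h. f h * indicator (- B) h \<partial>lborel)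
      = ennreal (\<kappa>\<^sup>2) * ((\<integral>\<^sup>+h. f h * indicator (- B \<inter> - E) h \<partial>lborel) + (\<integral>\<^sup>+h. f h * indicator (E - B) h \<partial>lborel))"
    by (subst nn_integral_add[symmetric]) (auto intro!: arg_cong2[where f="(*)"] nn_integral_cong simp: indicator_def)
  also have "\<dots> = ennreal (\<kappa>\<^sup>2) * (\<integral>\<^sup>+h. f h * indicator (- B \<inter> - E) h \<partial>lborel)
      + ennreal \<kappa> * (\<integral>\<^sup>+h. ennreal \<kappa> * f h * indicator (E - B) h \<partial>lborel)"
    by (simp add: distrib_left K mult.assoc nn_integral_cmult)
  \<comment> \<open>On the part outside both sets \<open>\<kappa>\<^sup>2 \<le> 1\<close> suffices.
    On \<open>E - B\<close> one factor \<open>\<kappa>\<close> is spent to reach the constant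
    \<open>c\<close>; the other is kept for the passage from \<open>c\<close> to the kernel on
    \<open>B - E\<close>.\<close>
  also have "\<dots> \<le> (\<integral>\<^sup>+h. f h * indicator (- B \<inter> - E) h \<partial>lborel) + ennreal \<kappa> * (\<integral>\<^sup>+h. c * indicator (E - B) h \<partial>lborel)"
  proof (intro add_mono mult_left_mono)
    show "ennreal (\<kappa>\<^sup>2) * (\<integral>\<^sup>+h. f h * indicator (- B \<inter> - E) h \<partial>lborel) \<le> (\<integral>\<^sup>+h. f h * indicator (- B \<inter> - E) h \<partial>lborel)"
      using kappa mult_right_mono[of "ennreal (\<kappa>\<^sup>2)" 1 "(\<integral>\<^sup>+h. f h * indicator (- B \<inter> - E) h \<partial>lborel)"]
      by (simp add: power_le_one)
    show "(\<integral>\<^sup>+h. ennreal \<kappa> * f h * indicator (E - B) h \<partial>lborel) \<le> (\<integral>\<^sup>+h. c * indicator (E - B) h \<partial>lborel)"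
      using out_ball by (intro nn_integral_mono_AE) (auto simp: indicator_def)
  qed simp
  also have "ennreal \<kappa> * (\<integral>\<^sup>+h. c * indicator (E - B) h \<partial>lborel) = (\<integral>\<^sup>+h. ennreal \<kappa> * c * indicator (B - E) h \<partial>lborel)"
    by (subst (1 2) nn_integral_cmult_indicator) (simp_all add: meq mult.assoc)
  also have "(\<integral>\<^sup>+h. f h * indicator (- B \<inter> - E) h \<partial>lborel) + \<dots>
      \<le> (\<integral>\<^sup>+h. f h * indicator (- B \<inter> - E) h \<partial>lborel) + (\<integral>\<^sup>+h. f h * indicator (B - E) h \<partial>lborel)"
    using in_ball by (intro add_left_mono nn_integral_mono_AE) (auto simp: indicator_def)
  also have "\<dots> = (\<integral>\<^sup>+h. f h * indicator (- E) h \<partial>lborel)"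
    by (subst nn_integral_add[symmetric]) (auto intro!: nn_integral_cong simp: indicator_def)
  finally show ?thesis by (simp add: B_def)
qed

text \<open>Reflecting or translating \<open>E\<close> keeps its volume \<open>a\<close>, so the
  comparison with the centred ball gives a bound uniform in \<open>x\<close>. Both signs of the
  difference occur because the fixed point may be either variable of the energy.\<close>

lemma kernel_complement:
  fixes \<nu> :: "'a::euclidean_space \<Rightarrow> real"
  assumes levy: "levy_kernel p \<nu>" and p: "1 \<le> p"
    and dec: "almost_decreasing \<kappa> \<nu>" and kappa: "0 < \<kappa>" "\<kappa> \<le> 1"
    and f[measurable]: "f \<in> borel_measurable borel" and fnu: "AE h in lborel. f h = ennreal (\<nu> h)"
    and E[measurable]: "E \<in> sets borel" and a: "0 < a" and Ea: "emeasure lborel E = ennreal a"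
  shows "ennreal (\<kappa>\<^sup>2 * kernel_tail \<nu> a) \<le> (\<integral>\<^sup>+y. f (x - y) * indicator (- E) y \<partial>lborel)" (is ?r)
    and "ennreal (\<kappa>\<^sup>2 * kernel_tail \<nu> a) \<le> (\<integral>\<^sup>+y. f (y - x) * indicator (- E) y \<partial>lborel)" (is ?t)
proof -
  let ?R = "ball_radius TYPE('a) a"
  have R: "0 < ?R" using a by (rule ball_radius_pos)
  have "ennreal (kernel_tail \<nu> a) = (\<integral>\<^sup>+h. f h * indicator (- ball 0 ?R) h \<partial>lborel)"
    unfolding ennreal_kernel_tail(1)[OF levy p a] nn_integral_completion
    using fnu by (intro nn_integral_cong_AE) auto
  then have tail: "ennreal (\<kappa>\<^sup>2 * kernel_tail \<nu> a) = ennreal (\<kappa>\<^sup>2) * (\<integral>\<^sup>+h. f h * indicator (- ball 0 ?R) h \<partial>lborel)"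
    by (simp add: ennreal_mult' )
  note rr = kernel_rearrange[OF levy dec kappa f fnu _ R, unfolded emeasure_ball_radius[OF a]]
  define E1 where "E1 = (\<lambda>h. x - h) -` E"
  have [measurable]: "E1 \<in> sets borel" unfolding E1_def
    using measurable_sets[of "\<lambda>h. x - h" borel borel E] by simp
  have "emeasure lborel E1 = emeasure lborel E"
    by (subst (2) lborel_distr_reflect[of x, symmetric]) (simp add: emeasure_distr E1_def)
  then have "ennreal (\<kappa>\<^sup>2 * kernel_tail \<nu> a) \<le> (\<integral>\<^sup>+h. f h * indicator (- E1) h \<partial>lborel)"
    unfolding tail by (intro rr) (auto simp: Ea)
  also have "\<dots> = (\<integral>\<^sup>+y. f (x - y) * indicator (- E1) (x - y) \<partial>lborel)"
    by (rule nn_integral_lborel_reflect[symmetric]) measurable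
  also have "\<dots> = (\<integral>\<^sup>+y. f (x - y) * indicator (- E) y \<partial>lborel)"
    by (auto intro!: nn_integral_cong simp: E1_def indicator_def)
  finally show ?r .
  define E2 where "E2 = (\<lambda>h. x + h) -` E"
  have [measurable]: "E2 \<in> sets borel" unfolding E2_def
    using measurable_sets[of "\<lambda>h. x + h" borel borel E] by simp
  have "emeasure lborel E2 = emeasure lborel E"
    by (subst (2) lborel_distr_plus[of x, symmetric]) (simp add: emeasure_distr E2_def)
  then have "ennreal (\<kappa>\<^sup>2 * kernel_tail \<nu> a) \<le> (\<integral>\<^sup>+h. f h * indicator (- E2) h \<partial>lborel)"
    unfolding tail by (intro rr) (auto simp: Ea)
  also have "\<dots> = (\<integral>\<^sup>+y. f (- x + y) * indicator (- E2) (- x + y) \<partial>lborel)"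
    by (rule nn_integral_lborel_translate[symmetric]) measurable
  also have "\<dots> = (\<integral>\<^sup>+y. f (y - x) * indicator (- E) y \<partial>lborel)"
    by (auto intro!: nn_integral_cong simp: E2_def indicator_def)
  finally show ?t .
qed

subsection \<open>Lower bound for the energy\<close>

lemma level_set_lebesgue:
  "u \<in> borel_measurable lebesgue \<Longrightarrow> {x. level t k < \<bar>u x\<bar>} \<in> sets lebesgue"
  by (intro borel_measurable_less[of _ lebesgue, simplified]) auto

lemma nonlocal_energy_borel_version:
  fixes u v :: "'a::euclidean_space \<Rightarrow> real"
  assumes fnu: "AE h in lborel. f h = ennreal (\<nu> h)" and uv: "AE x in lborel. u x = v x"
  shows "nonlocal_energy p \<nu> u = (\<integral>\<^sup>+x. (\<integral>\<^sup>+y. ennreal (\<bar>v x - v y\<bar> powr p) * f (x - y) \<partial>lborel) \<partial>lborel)"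
  unfolding nonlocal_energy_def nn_integral_completion
proof (rule nn_integral_cong_AE)
  show "AE x in lborel. (\<integral>\<^sup>+y. ennreal (\<bar>u x - u y\<bar> powr p * \<nu> (x - y)) \<partial>lborel)
      = (\<integral>\<^sup>+y. ennreal (\<bar>v x - v y\<bar> powr p) * f (x - y) \<partial>lborel)"
    using uv
  proof eventually_elim
    case (elim x)
    show ?case
    proof (rule nn_integral_cong_AE)
      show "AE y in lborel. ennreal (\<bar>u x - u y\<bar> powr p * \<nu> (x - y)) = ennreal (\<bar>v x - v y\<bar> powr p) * f (x - y)"
        using uv AE_lborel_reflect[OF fnu, of x]
        by eventually_elim (simp add: elim ennreal_mult')
    qed
  qed
qed

text \<open>Level \<open>k\<close> is charged with the pairs having one point in
  \<open>A (k + 1)\<close> and the other outside \<open>A k\<close>. With the first point fixed, the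
  kernel mass outside \<open>A k\<close> is at least
  \<open>\<kappa>\<^sup>2 * kernel_tail \<nu> (a k)\<close>. The two orders of a pair give the
  factor \<open>2\<close>. The levels are summed under the integral, where the pointwise jump
  inequality excludes overcounting.\<close>

lemma energy_lower_bound:
  fixes \<nu> u :: "'a::euclidean_space \<Rightarrow> real"
  assumes levy: "levy_kernel p \<nu>" and p: "1 \<le> p"
    and dec: "almost_decreasing \<kappa> \<nu>" and kappa: "0 < \<kappa>" "\<kappa> \<le> 1"
    and u: "u \<in> borel_measurable lebesgue" and t: "2 \<le> t" and K: "finite K"
    and fin: "\<And>k. emeasure lebesgue {x. level t k < \<bar>u x\<bar>} < \<infinity>"
  defines "a \<equiv> \<lambda>k. measure lebesgue {x. level t k < \<bar>u x\<bar>}"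
  shows "ennreal (2 * \<kappa>\<^sup>2 * (\<Sum>k\<in>K. level t k powr p * a (k + 1) * kernel_tail \<nu> (a k))) \<le> nonlocal_energy p \<nu> u"
proof -
  obtain f :: "'a \<Rightarrow> ennreal" where f[measurable]: "f \<in> borel_measurable borel"
    and fnu: "AE h in lborel. f h = ennreal (\<nu> h)"
    using levy_kernel_borel_version[OF levy] by blast
  obtain v where v[measurable]: "v \<in> borel_measurable borel" and uv: "AE x in lborel. u x = v x"
    using completion_ex_borel_measurable_real[OF u] by auto
  define A where "A k = {x. level t k < \<bar>v x\<bar>}" for k
  have [measurable]: "A k \<in> sets borel" for k unfolding A_def by measurable
  have Aa: "emeasure lborel (A k) = ennreal (a k)" for k
  proof -
    have ul: "{x. level t k < \<bar>u x\<bar>} \<in> sets lebesgue"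
      by (rule level_set_lebesgue[OF u])
    have "ennreal (a k) = emeasure lebesgue {x. level t k < \<bar>u x\<bar>}"
      using fin[of k] by (simp add: a_def emeasure_eq_ennreal_measure)
    also have "\<dots> = emeasure lebesgue (A k)"
      using ul uv by (intro emeasure_eq_AE) (auto simp: A_def AE_completion_iff)
    finally show ?thesis by simp
  qed
  have a0: "0 \<le> a k" for k by (simp add: a_def)
  define c where "c k = level t k powr p" for k
  have c0: "0 \<le> c k" for k by (simp add: c_def)
  have sub: "A (k + 1) \<subseteq> A k" for k using level_mono[of t k "k + 1"] t by (auto simp: A_def)
  \<comment> \<open>The tail is controlled only at positive arguments. If \<open>a k = 0\<close>,
    then \<open>a (k + 1) = 0\<close> as well and the whole term vanishes.\<close>
  have a_pos: "0 < a k" if "a (k + 1) \<noteq> 0" for k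
  proof -
    have "ennreal (a (k + 1)) \<le> ennreal (a k)"
      unfolding Aa[symmetric] by (intro emeasure_mono sub) simp
    then have "a (k + 1) \<le> a k" by (simp add: a0)
    with that a0[of "k + 1"] show ?thesis by linarith
  qed
  have nonneg: "0 \<le> 2 * \<kappa>\<^sup>2 * (c k * a (k + 1) * kernel_tail \<nu> (a k))" for k
    using a_pos[of k] ennreal_kernel_tail(2)[OF levy p, of "a k"] c0[of k] a0[of "k + 1"]
    by (cases "a (k + 1) = 0") auto
  have summand: "ennreal (2 * \<kappa>\<^sup>2 * (c k * a (k + 1) * kernel_tail \<nu> (a k))) \<le>
      (\<integral>\<^sup>+x. (\<integral>\<^sup>+y. ennreal (c k) * (indicator (A (k + 1)) x * indicator (- A k) y + indicator (- A k) x * indicator (A (k + 1)) y) * f (x - y) \<partial>lborel) \<partial>lborel)"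
    (is "_ \<le> ?I") for k
  proof (cases "a (k + 1) = 0")
    case False
    have pos: "0 < a k" by (rule a_pos[OF False])
    have tail0: "0 \<le> kernel_tail \<nu> (a k)" by (rule ennreal_kernel_tail(2)[OF levy p pos])
    note kc = kernel_complement[OF levy p dec kappa f fnu _ pos Aa, simplified]
    let ?s = "ennreal (\<kappa>\<^sup>2 * kernel_tail \<nu> (a k))"
    have "?s * ennreal (a (k + 1)) = (\<integral>\<^sup>+x. ?s * indicator (A (k + 1)) x \<partial>lborel)"
      by (subst nn_integral_cmult_indicator) (simp_all add: Aa)
    also have "\<dots> \<le> (\<integral>\<^sup>+x. (\<integral>\<^sup>+y. f (x - y) * indicator (- A k) y \<partial>lborel) * indicator (A (k + 1)) x \<partial>lborel)"
      by (intro nn_integral_mono mult_right_mono kc) simp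
    also have "\<dots> = (\<integral>\<^sup>+x. (\<integral>\<^sup>+y. indicator (A (k + 1)) x * indicator (- A k) y * f (x - y) \<partial>lborel) \<partial>lborel)"
      by (intro nn_integral_cong) (auto simp: indicator_def mult.commute)
    finally have 1: "?s * ennreal (a (k + 1)) \<le> (\<integral>\<^sup>+x. (\<integral>\<^sup>+y. indicator (A (k + 1)) x * indicator (- A k) y * f (x - y) \<partial>lborel) \<partial>lborel)" .
    \<comment> \<open>The other order of the pair: now \<open>y\<close> is the fixed point, the
      rearrangement acts on \<open>x\<close>, and Fubini restores the order of integration.\<close>
    have "?s * ennreal (a (k + 1)) = (\<integral>\<^sup>+y. ?s * indicator (A (k + 1)) y \<partial>lborel)"
      by (subst nn_integral_cmult_indicator) (simp_all add: Aa)
    also have "\<dots> \<le> (\<integral>\<^sup>+y. (\<integral>\<^sup>+x. f (x - y) * indicator (- A k) x \<partial>lborel) * indicator (A (k + 1)) y \<partial>lborel)"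
      by (intro nn_integral_mono mult_right_mono kc) simp
    also have "\<dots> = (\<integral>\<^sup>+y. (\<integral>\<^sup>+x. indicator (- A k) x * indicator (A (k + 1)) y * f (x - y) \<partial>lborel) \<partial>lborel)"
      by (intro nn_integral_cong) (auto simp: indicator_def mult.commute)
    also have "\<dots> = (\<integral>\<^sup>+x. (\<integral>\<^sup>+y. indicator (- A k) x * indicator (A (k + 1)) y * f (x - y) \<partial>lborel) \<partial>lborel)"
      by (rule lborel_pair.Fubini') measurable
    finally have 2: "?s * ennreal (a (k + 1)) \<le> \<dots>" .
    have eq: "2 * \<kappa>\<^sup>2 * (c k * a (k + 1) * kernel_tail \<nu> (a k)) =
      c k * (\<kappa>\<^sup>2 * kernel_tail \<nu> (a k) * a (k + 1) + \<kappa>\<^sup>2 * kernel_tail \<nu> (a k) * a (k + 1))"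
      by (simp add: algebra_simps)
    have "ennreal (2 * \<kappa>\<^sup>2 * (c k * a (k + 1) * kernel_tail \<nu> (a k)))
        = ennreal (c k) * (?s * ennreal (a (k + 1)) + ?s * ennreal (a (k + 1)))"
      unfolding eq using tail0 c0 a0 by (simp only: ennreal_mult ennreal_plus mult_nonneg_nonneg add_nonneg_nonneg zero_le_power2)
    also have "\<dots> \<le> ennreal (c k) * ((\<integral>\<^sup>+x. (\<integral>\<^sup>+y. indicator (A (k + 1)) x * indicator (- A k) y * f (x - y) \<partial>lborel) \<partial>lborel)
       + (\<integral>\<^sup>+x. (\<integral>\<^sup>+y. indicator (- A k) x * indicator (A (k + 1)) y * f (x - y) \<partial>lborel) \<partial>lborel))"
      by (intro mult_left_mono add_mono 1 2) simp
    also have "\<dots> = ?I"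
      by (simp add: nn_integral_add[symmetric] nn_integral_cmult[symmetric] distrib_left distrib_right mult.assoc)
    finally show ?thesis .
  qed simp
  have "ennreal (2 * \<kappa>\<^sup>2 * (\<Sum>k\<in>K. c k * a (k + 1) * kernel_tail \<nu> (a k)))
      = ennreal (\<Sum>k\<in>K. 2 * \<kappa>\<^sup>2 * (c k * a (k + 1) * kernel_tail \<nu> (a k)))"
    by (simp add: sum_distrib_left)
  also have "\<dots> = (\<Sum>k\<in>K. ennreal (2 * \<kappa>\<^sup>2 * (c k * a (k + 1) * kernel_tail \<nu> (a k))))"
    by (rule sum_ennreal[symmetric]) (rule nonneg)
  also have "\<dots> \<le> (\<Sum>k\<in>K. \<integral>\<^sup>+x. (\<integral>\<^sup>+y. ennreal (c k) * (indicator (A (k + 1)) x * indicator (- A k) y + indicator (- A k) x * indicator (A (k + 1)) y) * f (x - y) \<partial>lborel) \<partial>lborel)"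
    by (intro sum_mono summand)
  also have "\<dots> = (\<integral>\<^sup>+x. (\<integral>\<^sup>+y. (\<Sum>k\<in>K. ennreal (c k) * (indicator (A (k + 1)) x * indicator (- A k) y + indicator (- A k) x * indicator (A (k + 1)) y)) * f (x - y) \<partial>lborel) \<partial>lborel)"
    by (simp add: nn_integral_sum sum_distrib_right)
  also have "\<dots> \<le> (\<integral>\<^sup>+x. (\<integral>\<^sup>+y. ennreal (\<bar>v x - v y\<bar> powr p) * f (x - y) \<partial>lborel) \<partial>lborel)"
  proof (intro nn_integral_mono mult_right_mono)
    fix x y
    have "(\<Sum>k\<in>K. ennreal (c k) * (indicator (A (k + 1)) x * indicator (- A k) y + indicator (- A k) x * indicator (A (k + 1)) y))
      = (\<Sum>k\<in>K. ennreal (c k * (indicator (A (k + 1)) x * indicator (- A k) y + indicator (- A k) x * indicator (A (k + 1)) y)))"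
      by (intro sum.cong refl) (auto simp: indicator_def ennreal_mult' dest: subsetD[OF sub])
    also have "\<dots> = ennreal (\<Sum>k\<in>K. c k * (indicator (A (k + 1)) x * indicator (- A k) y + indicator (- A k) x * indicator (A (k + 1)) y))"
      by (rule sum_ennreal) (simp add: c0)
    also have "(\<Sum>k\<in>K. c k * (indicator (A (k + 1)) x * indicator (- A k) y + indicator (- A k) x * indicator (A (k + 1)) y))
       = (\<Sum>k\<in>K. level t k powr p *
      (indicator {z. level t (k + 1) < \<bar>z\<bar>} (v x) * indicator {z. \<bar>z\<bar> \<le> level t k} (v y)
       + indicator {z. \<bar>z\<bar> \<le> level t k} (v x) * indicator {z. level t (k + 1) < \<bar>z\<bar>} (v y)))"
      by (intro sum.cong refl) (auto simp: indicator_def A_def c_def)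
    also have "\<dots> \<le> \<bar>v x - v y\<bar> powr p" by (rule level_jump_sum_le[OF t p K])
    finally show "(\<Sum>k\<in>K. ennreal (c k) * (indicator (A (k + 1)) x * indicator (- A k) y + indicator (- A k) x * indicator (A (k + 1)) y))
       \<le> ennreal (\<bar>v x - v y\<bar> powr p)" by (simp add: ennreal_leI)
  qed simp
  also have "\<dots> = nonlocal_energy p \<nu> u" by (rule nonlocal_energy_borel_version[OF fnu uv, symmetric])
  finally show ?thesis by (simp add: c_def)
qed

subsection \<open>The Orlicz norm\<close>

locale potential_setting =
  fixes p \<kappa> \<theta> :: real
    and \<nu> :: "'a::euclidean_space \<Rightarrow> real"
    and \<phi> :: "real \<Rightarrow> real"
  assumes p: "1 \<le> p"
    and levy: "levy_kernel p \<nu>"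
    and kappa: "0 < \<kappa>" "\<kappa> \<le> 1"
    and almost_dec: "almost_decreasing \<kappa> \<nu>"
    and bij: "bij_betw (recip_potential p \<nu>) {0..} {0..}"
    and inverse: "\<And>s. 0 \<le> s \<Longrightarrow> \<phi> s = the_inv_into {0..} (recip_potential p \<nu>) s"
    and convex_p: "convex_on {0..} (\<lambda>s. \<phi> (s powr (1 / p)))"
    and theta: "0 < \<theta>"
    and growth: "\<And>s t. 0 \<le> s \<Longrightarrow> s \<le> t \<Longrightarrow> 0 < t \<Longrightarrow> \<phi> (\<theta> * (s / t)) \<le> \<phi> s / \<phi> t"
begin

text \<open>The convex function \<open>\<phi>_p\<close> of the English statement. Monotonicity of
  \<open>\<phi>\<close> is also derived through it.\<close>

definition \<psi> :: "real \<Rightarrow> real" where "\<psi> s = \<phi> (s powr (1 / p))"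

lemma phi_recip: "0 \<le> t \<Longrightarrow> \<phi> (recip_potential p \<nu> t) = t"
  using bij by (subst inverse) (auto simp: bij_betw_def intro!: the_inv_into_f_f)

lemma phi_zero: "\<phi> 0 = 0"
  using phi_recip[of 0] by (simp add: recip_potential_def)

lemma phi_nonneg: "0 \<le> s \<Longrightarrow> 0 \<le> \<phi> s"
  using bij the_inv_into_into[of "recip_potential p \<nu>" "{0..}" s "{0..}"]
  by (subst inverse) (auto simp: bij_betw_def)

lemma phi_pos: "0 < s \<Longrightarrow> 0 < \<phi> s"
proof -
  assume s: "0 < s"
  then have "recip_potential p \<nu> (\<phi> s) = s"
    using bij by (subst inverse) (auto simp: bij_betw_def intro!: f_the_inv_into_f)
  with s have "\<phi> s \<noteq> 0" by (auto simp: recip_potential_def)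
  with phi_nonneg[of s] s show ?thesis by simp
qed

lemma potential_pos:
  assumes "0 < a"
  shows "0 < potential p \<nu> a" and "\<phi> (1 / potential p \<nu> a) = 1 / a"
proof -
  have eq: "recip_potential p \<nu> (1 / a) = 1 / potential p \<nu> a"
    using assms by (simp add: recip_potential_def)
  show "\<phi> (1 / potential p \<nu> a) = 1 / a"
    using phi_recip[of "1 / a"] assms by (simp add: eq)
  \<comment> \<open>With \<open>1 / 0 = 0\<close>, a vanishing potential would give
    \<open>\<phi> 0 = 1 / a\<close>, against \<open>\<phi> 0 = 0\<close>.\<close>
  then have "potential p \<nu> a \<noteq> 0" using assms by (auto simp: phi_zero)
  moreover have "0 \<le> potential p \<nu> a" by (simp add: potential_def)
  ultimately show "0 < potential p \<nu> a" by simp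
qed

lemma potential_powr:
  assumes "0 < a"
  shows "potential p \<nu> a powr p = a * kernel_tail \<nu> a"
  using assms p ennreal_kernel_tail(2)[OF levy p assms]
  by (simp add: potential_def kernel_tail_def powr_powr)

lemma kernel_tail_pos: "0 < a \<Longrightarrow> 0 < kernel_tail \<nu> a"
  using potential_pos(1)[of a] potential_powr[of a] ennreal_kernel_tail(2)[OF levy p, of a]
  by (cases "kernel_tail \<nu> a = 0") auto

lemma phi_psi: "0 \<le> s \<Longrightarrow> \<phi> s = \<psi> (s powr p)"
  using p by (simp add: \<psi>_def powr_powr)

lemma psi_zero: "\<psi> 0 = 0"
  by (simp add: \<psi>_def phi_zero)

lemma psi_pos: "0 < s \<Longrightarrow> 0 < \<psi> s"
  by (simp add: \<psi>_def phi_pos)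

lemma psi_nonneg: "0 \<le> \<psi> s"
  by (simp add: \<psi>_def phi_nonneg)

text \<open>Convexity on the segment from \<open>0\<close> to \<open>y\<close>, with
  \<open>\<psi> 0 = 0\<close>. The monotonicity lemmas below rest on it.\<close>

lemma psi_scale:
  assumes "0 \<le> c" "c \<le> 1" "0 \<le> y"
  shows "\<psi> (c * y) \<le> c * \<psi> y"
  using convex_onD[OF convex_p, of c 0 y] assms by (simp add: \<psi>_def phi_zero)

lemma psi_mono:
  assumes "0 \<le> x" "x \<le> y"
  shows "\<psi> x \<le> \<psi> y"
proof (cases "y = 0")
  case False
  with assms have y: "0 < y" by simp
  have "\<psi> x = \<psi> (x / y * y)" using y by simp
  also have "\<dots> \<le> x / y * \<psi> y" using assms y by (intro psi_scale) auto
  also have "\<dots> \<le> 1 * \<psi> y" using assms y psi_nonneg by (intro mult_right_mono) auto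
  finally show ?thesis by simp
qed (use assms in auto)

lemma psi_strict_mono:
  assumes "0 \<le> x" "x < y"
  shows "\<psi> x < \<psi> y"
proof -
  have y: "0 < y" using assms by simp
  have "\<psi> x = \<psi> (x / y * y)" using y by simp
  also have "\<dots> \<le> x / y * \<psi> y" using assms y by (intro psi_scale) auto
  also have "\<dots> < 1 * \<psi> y" using assms y psi_pos by (intro mult_strict_right_mono) auto
  finally show ?thesis by simp
qed

lemma phi_mono: "0 \<le> x \<Longrightarrow> x \<le> y \<Longrightarrow> \<phi> x \<le> \<phi> y"
  using p by (simp add: phi_psi psi_mono powr_mono2)

text \<open>The relation between the potential and the inverse of \<open>\<phi>\<close>, raised to
  the power \<open>p\<close>: it turns \<open>g a = a * kernel_tail \<nu> a\<close> back into the
  measure \<open>a\<close>.\<close>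

lemma psi_inverse:
  assumes "0 < a"
  shows "\<psi> (1 / (a * kernel_tail \<nu> a)) = 1 / a"
proof -
  have "(1 / potential p \<nu> a) powr p = 1 / (a * kernel_tail \<nu> a)"
    using potential_pos(1)[OF assms] by (simp add: powr_divide potential_powr[OF assms])
  then show ?thesis
    using potential_pos[OF assms] phi_psi[of "1 / potential p \<nu> a"] by simp
qed

lemma supporting_line:
  assumes "0 < z0"
  obtains m where "0 \<le> m" "\<And>z. 0 \<le> z \<Longrightarrow> \<psi> z0 + m * (z - z0) \<le> \<psi> z"
proof -
  \<comment> \<open>The right derivative of \<open>\<psi>\<close> at \<open>z0\<close>, as an
    infimum of difference quotients. Its sign follows below by evaluating the supporting line at
    \<open>0\<close>, where \<open>\<psi>\<close> vanishes.\<close>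
  define m where "m = Inf ((\<lambda>t. (\<psi> z0 - \<psi> t) / (z0 - t)) ` ({z0<..} \<inter> {0..}))"
  have cv: "convex_on {0..} \<psi>" using convex_p by (simp add: \<psi>_def[abs_def])
  have line: "\<psi> z0 + m * (z - z0) \<le> \<psi> z" if "0 \<le> z" for z
    unfolding m_def using assms that by (intro convex_le_Inf_differential[OF cv]) auto
  have "\<psi> z0 \<le> m * z0" using line[of 0] by (simp add: psi_zero)
  then have "0 \<le> m * z0" using psi_nonneg[of z0] by linarith
  then have "0 \<le> m" using assms by (simp add: zero_le_mult_iff)
  with line that show ?thesis by blast
qed

text \<open>For \<open>b > 0\<close>, apply the growth condition to the reciprocal potentials
  \<open>r\<close> at \<open>a\<close> and \<open>s\<close> at \<open>b\<close>:
  \<open>\<phi> r / \<phi> s\<close> is \<open>b / a\<close>, and the p-th power of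
  \<open>r / s\<close> is the quotient of the two values of \<open>a * kernel_tail \<nu> a\<close>.
  The required \<open>r \<le> s\<close> is \<open>b \<le> a\<close> seen through
  \<open>\<phi>\<close>.\<close>

lemma growth_ratio:
  assumes "0 \<le> b" "b \<le> a" "0 < a"
  shows "\<psi> (\<theta> powr p * (b * kernel_tail \<nu> b / (a * kernel_tail \<nu> a))) \<le> b / a"
proof (cases "b = 0")
  case False
  with assms have b: "0 < b" by simp
  define r s where "r = 1 / potential p \<nu> a" and "s = 1 / potential p \<nu> b"
  have rs: "0 < r" "0 < s" "\<phi> r = 1 / a" "\<phi> s = 1 / b"
    using potential_pos[OF \<open>0 < a\<close>] potential_pos[OF b] by (auto simp: r_def s_def)
  have "r \<le> s"
  proof (rule ccontr)
    assume "\<not> r \<le> s"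
    then have "\<phi> s < \<phi> r"
      using rs(1,2) p unfolding phi_psi[OF less_imp_le[OF rs(1)]] phi_psi[OF less_imp_le[OF rs(2)]]
      by (intro psi_strict_mono powr_less_mono2) auto
    then show False using assms b rs by (simp add: field_simps)
  qed
  from growth[OF _ this] rs have "\<phi> (\<theta> * (r / s)) \<le> b / a" by (simp add: mult.commute)
  moreover have "\<phi> (\<theta> * (r / s)) = \<psi> (\<theta> powr p * (b * kernel_tail \<nu> b / (a * kernel_tail \<nu> a)))"
    using rs theta potential_pos[OF \<open>0 < a\<close>] potential_pos[OF b]
    by (simp add: phi_psi powr_mult powr_divide r_def s_def potential_powr assms b)
  ultimately show ?thesis by simp
qed (simp add: psi_zero)

text \<open>On the shell above level \<open>k\<close>, dividing by \<open>t\<close> absorbs the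
  upper end of the shell, and the p-th power of what remains is the fraction \<open>x k / X\<close>
  of \<open>1 / (a k * kernel_tail \<nu> (a k))\<close>. Convexity pulls the fraction out and leaves
  \<open>x k / X / a k\<close>; the shell has measure at most \<open>a k\<close>, so it contributes
  at most \<open>x k / X\<close>, and these add up to at most \<open>1\<close>.\<close>

lemma modular_le_one:
  fixes u :: "'a \<Rightarrow> real"
  assumes u: "u \<in> borel_measurable lebesgue" and t: "1 < t"
    and fin: "\<And>k. emeasure lebesgue {x. level t k < \<bar>u x\<bar>} < \<infinity>"
    and X: "0 < X"
    and sum: "\<And>N::nat. (\<Sum>k\<in>{-int N..<int N}. level t k powr p *
        (measure lebesgue {x. level t k < \<bar>u x\<bar>} * kernel_tail \<nu> (measure lebesgue {x. level t k < \<bar>u x\<bar>}))) \<le> X"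
  shows "orlicz_modular (extend_infty \<phi>) u (t * X powr (1 / p)) \<le> 1"
proof -
  define A where "A k = {x. level t k < \<bar>u x\<bar>}" for k
  define a where "a k = measure lebesgue (A k)" for k
  define x where "x k = level t k powr p * (a k * kernel_tail \<nu> (a k))" for k
  \<comment> \<open>A shell with \<open>a k = 0\<close> is null: the value
    \<open>\<infinity>\<close> makes the pointwise bound trivial there and costs nothing in the
    integral, as \<open>\<infinity> * 0 = 0\<close>.\<close>
  define h where "h k = (if a k = 0 then \<infinity> else ennreal (x k / X / a k))" for k
  have a0: "0 \<le> a k" for k by (simp add: a_def)
  have x0: "0 \<le> x k" for k
    using a0[of k] kernel_tail_pos[of "a k"] by (cases "a k = 0") (auto simp: x_def)
  have xX: "(\<Sum>k\<in>{-int N..<int N}. x k) \<le> X" for N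
    using sum[of N] by (simp add: x_def a_def A_def)
  \<comment> \<open>Makes \<open>x k / X\<close> an admissible weight for \<open>psi_scale\<close>:
    the term is bounded by a symmetric partial sum containing it.\<close>
  have x_le: "x k \<le> X" for k
  proof -
    have "x k \<le> (\<Sum>k\<in>{-int (nat \<bar>k\<bar> + 1)..<int (nat \<bar>k\<bar> + 1)}. x k)"
      using x0 by (intro member_le_sum) auto
    then show ?thesis using xX[of "nat \<bar>k\<bar> + 1"] by linarith
  qed
  have A[measurable]: "A k \<in> sets lebesgue" for k
    unfolding A_def by (rule level_set_lebesgue[OF u])
  define D where "D k = A k - A (k + 1)" for k
  have D[measurable]: "D k \<in> sets lebesgue" for k by (simp add: D_def sets.Diff)
  define H where "H N y = (\<Sum>k\<in>{-int N..<int N}. h k * indicator (D k) y)" for N y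
  have Hm[measurable]: "H N \<in> borel_measurable lebesgue" for N unfolding H_def by measurable
  have "incseq H"
  proof (intro incseq_SucI le_funI)
    fix N y show "H N y \<le> H (Suc N) y" unfolding H_def by (rule sum_mono2) auto
  qed
  have hD: "(\<integral>\<^sup>+y. h k * indicator (D k) y \<partial>lebesgue) \<le> ennreal (x k / X)" for k
  proof -
    have "(\<integral>\<^sup>+y. h k * indicator (D k) y \<partial>lebesgue) = h k * emeasure lebesgue (D k)"
      by (rule nn_integral_cmult_indicator) simp
    also have "\<dots> \<le> h k * emeasure lebesgue (A k)"
      by (intro mult_left_mono emeasure_mono) (auto simp: D_def)
    also have "emeasure lebesgue (A k) = ennreal (a k)"
      using fin[of k] by (simp add: a_def A_def emeasure_eq_ennreal_measure)
    also have "h k * ennreal (a k) \<le> ennreal (x k / X)"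
      using a0[of k] x0[of k] X by (auto simp: h_def ennreal_mult[symmetric])
    finally show ?thesis .
  qed
  have HN: "(\<integral>\<^sup>+y. H N y \<partial>lebesgue) \<le> 1" for N
  proof -
    have "(\<integral>\<^sup>+y. H N y \<partial>lebesgue) = (\<Sum>k\<in>{-int N..<int N}. \<integral>\<^sup>+y. h k * indicator (D k) y \<partial>lebesgue)"
      unfolding H_def by (rule nn_integral_sum) simp
    also have "\<dots> \<le> (\<Sum>k\<in>{-int N..<int N}. ennreal (x k / X))" by (intro sum_mono hD)
    also have "\<dots> = ennreal (\<Sum>k\<in>{-int N..<int N}. x k / X)" using x0 X by (intro sum_ennreal) auto
    also have "\<dots> \<le> 1" using xX[of N] X by (simp add: sum_divide_distrib[symmetric])
    finally show ?thesis .
  qed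
  have point: "extend_infty \<phi> (ennreal (\<bar>u y\<bar> / (t * X powr (1 / p)))) \<le> (SUP N. H N y)" for y
  proof (cases "u y = 0")
    case True
    then show ?thesis by (simp add: extend_infty_def phi_zero)
  next
    case False
    then obtain k where k: "level t k < \<bar>u y\<bar>" "\<bar>u y\<bar> \<le> level t (k + 1)"
      using exists_level_bracket[OF t, of "\<bar>u y\<bar>"] by auto
    have lam: "0 < t * X powr (1 / p)" using t X by simp
    have yD: "y \<in> D k" using k by (simp add: D_def A_def)
    have "extend_infty \<phi> (ennreal (\<bar>u y\<bar> / (t * X powr (1 / p)))) \<le> h k"
    proof (cases "a k = 0")
      case False
      then have ak: "0 < a k" using a0[of k] by simp
      have lp: "0 < level t k" using t by simp
      have "\<bar>u y\<bar> / (t * X powr (1 / p)) \<le> level t (k + 1) / (t * X powr (1 / p))"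
        using k lam by (intro divide_right_mono) auto
      also have "\<dots> = level t k / X powr (1 / p)" using t by (simp add: level_Suc)
      finally have "\<phi> (\<bar>u y\<bar> / (t * X powr (1 / p))) \<le> \<phi> (level t k / X powr (1 / p))"
        using lam by (intro phi_mono) auto
      also have "\<dots> = \<psi> ((level t k / X powr (1 / p)) powr p)" using lp by (intro phi_psi) auto
      also have "(level t k / X powr (1 / p)) powr p = x k / X * (1 / (a k * kernel_tail \<nu> (a k)))"
        using ak kernel_tail_pos[OF ak] X p lp by (simp add: x_def powr_divide powr_powr)
      also have "\<psi> \<dots> \<le> x k / X * \<psi> (1 / (a k * kernel_tail \<nu> (a k)))"
        using x0 X x_le[of k] ak kernel_tail_pos[OF ak] by (intro psi_scale) auto
      also have "\<dots> = x k / X / a k" by (simp add: psi_inverse[OF ak])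
      finally show ?thesis
        using lam ak by (simp add: extend_infty_def h_def ennreal_leI)
    qed (simp add: h_def)
    also have "h k = h k * indicator (D k) y" using yD by simp
    also have "\<dots> \<le> H (nat \<bar>k\<bar> + 1) y"
      unfolding H_def by (rule member_le_sum) auto
    also have "\<dots> \<le> (SUP N. H N y)" by (rule SUP_upper) simp
    finally show ?thesis .
  qed
  have "orlicz_modular (extend_infty \<phi>) u (t * X powr (1 / p)) \<le> (\<integral>\<^sup>+y. (SUP N. H N y) \<partial>lebesgue)"
    unfolding orlicz_modular_def by (intro nn_integral_mono point)
  also have "\<dots> = (SUP N. \<integral>\<^sup>+y. H N y \<partial>lebesgue)"
    by (rule nn_integral_monotone_convergence_SUP[OF \<open>incseq H\<close>]) simp
  also have "\<dots> \<le> 1" by (intro SUP_least HN)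
  finally show ?thesis .
qed

text \<open>The conditions on \<open>t\<close> amount to what is needed for
  \<open>t powr p > 2\<close>: strictness comes from the exponent if \<open>p > 1\<close>, and from
  \<open>t\<close> itself if \<open>p = 1\<close>.\<close>

lemma C_const_bounds:
  assumes "2 \<le> t" "p = 1 \<longrightarrow> 2 < t"
  shows "0 < C_const p t" "C_const p t \<le> 1"
proof -
  have "2 < t powr p"
  proof (cases "p = 1")
    case False
    then have "2 powr 1 < (2::real) powr p" using p by (intro powr_less_mono) auto
    also have "\<dots> \<le> t powr p" using assms p by (intro powr_mono2) auto
    finally show ?thesis by simp
  qed (use assms in auto)
  then show "0 < C_const p t" "C_const p t \<le> 1" by (auto simp: C_const_def field_simps)
qed

lemma Theta_const_pos:
  assumes "2 \<le> t" "p = 1 \<longrightarrow> 2 < t"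
  shows "0 < Theta_const p \<kappa> \<theta> \<phi> t"
  using C_const_bounds(1)[OF assms] assms kappa theta phi_pos[of "\<theta> / t"]
  by (simp add: Theta_const_def)

text \<open>Stated for every positive \<open>l\<close> above the claimed bound, because the bound is
  \<open>0\<close> when the energy vanishes and the modular needs a positive scale.\<close>

lemma modular_le_one_of_energy:
  fixes u :: "'a \<Rightarrow> real"
  assumes u: "u \<in> borel_measurable lebesgue" and t: "2 \<le> t" "p = 1 \<longrightarrow> 2 < t"
    and fin: "\<And>k. emeasure lebesgue {x. level t k < \<bar>u x\<bar>} < \<infinity>"
  defines "a \<equiv> \<lambda>k. measure lebesgue {x. level t k < \<bar>u x\<bar>}"
  assumes bdd: "\<And>k. k \<le> 0 \<Longrightarrow> level t k powr p * (a k * kernel_tail \<nu> (a k)) \<le> B"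
    and E: "nonlocal_energy p \<nu> u < \<infinity>"
    and l: "0 < l" "Theta_const p \<kappa> \<theta> \<phi> t * enn2real (nonlocal_energy p \<nu> u) powr (1 / p) \<le> l"
  shows "orlicz_modular (extend_infty \<phi>) u l \<le> 1"
proof -
  define e where "e = enn2real (nonlocal_energy p \<nu> u)"
  define c where "c = \<phi> (\<theta> / t)"
  define x where "x k = level t k powr p * (a k * kernel_tail \<nu> (a k))" for k
  define s where "s k = level t k powr p * a (k + 1) * kernel_tail \<nu> (a k)" for k
  define z0 where "z0 = (\<theta> / t) powr p"
  have tp: "0 < t" using t by simp
  have c: "0 < c" using theta tp by (simp add: c_def phi_pos)
  have cz: "c = \<psi> z0" using theta tp by (simp add: c_def z0_def phi_psi)
  have z0: "0 < z0" using theta tp by (simp add: z0_def)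
  obtain m where m: "0 \<le> m" "\<And>z. 0 \<le> z \<Longrightarrow> \<psi> z0 + m * (z - z0) \<le> \<psi> z"
    using supporting_line[OF z0] by blast
  have a0: "0 \<le> a k" for k by (simp add: a_def)
  have amono: "a (k + 1) \<le> a k" for k
  proof -
    have "{x. level t k < \<bar>u x\<bar>} \<in> lmeasurable" for k
      using fin u by (intro fmeasurableI level_set_lebesgue) auto
    moreover have "level t k \<le> level t (k + 1)" using t by (intro level_mono) auto
    ultimately show ?thesis unfolding a_def by (intro measure_mono_fmeasurable) (auto dest: fmeasurableD)
  qed
  have x0: "0 \<le> x k" for k
    using a0[of k] kernel_tail_pos[of "a k"] by (cases "a k = 0") (auto simp: x_def)
  have s: "c * x k + m * z0 * (x (k + 1) - x k) \<le> s k" for k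
  proof (cases "a k = 0")
    case True
    then have "a (k + 1) = 0" using amono[of k] a0[of "k + 1"] by simp
    with True show ?thesis by (simp add: x_def s_def)
  next
    case False
    with a0[of k] have ak: "0 < a k" by simp
    define g where "g j = a j * kernel_tail \<nu> (a j)" for j
    have gk: "0 < g k" using ak kernel_tail_pos[OF ak] by (simp add: g_def)
    have gk1: "0 \<le> g (k + 1)"
      using a0[of "k + 1"] kernel_tail_pos[of "a (k + 1)"] by (cases "a (k + 1) = 0") (auto simp: g_def)
    have "c + m * (\<theta> powr p * (g (k + 1) / g k) - z0) \<le> \<psi> (\<theta> powr p * (g (k + 1) / g k))"
      unfolding cz using gk gk1 by (intro m) auto
    also have "\<dots> \<le> a (k + 1) / a k"
      unfolding g_def by (rule growth_ratio[OF a0 amono ak])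
    finally have "x k * (c + m * (\<theta> powr p * (g (k + 1) / g k) - z0)) \<le> x k * (a (k + 1) / a k)"
      using x0 by (rule mult_left_mono)
    moreover have "x k * (a (k + 1) / a k) = s k" using ak by (simp add: x_def s_def)
    \<comment> \<open>Here the choice of \<open>z0\<close> pays off:
      \<open>z0 * t powr p = \<theta> powr p\<close>, and \<open>t powr p\<close> is exactly the
      factor by which the level grows from \<open>x k\<close> to \<open>x (k + 1)\<close>.\<close>
    moreover have "x k * (c + m * (\<theta> powr p * (g (k + 1) / g k) - z0)) = c * x k + m * z0 * (x (k + 1) - x k)"
    proof -
      have xk: "x k = level t k powr p * g k" by (simp add: x_def g_def)
      have xk1: "x (k + 1) = t powr p * level t k powr p * g (k + 1)"
        using tp by (simp add: x_def g_def level_Suc powr_mult)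
      have tz: "z0 * t powr p = \<theta> powr p" using theta tp by (simp add: z0_def powr_divide)
      define r where "r = \<theta> powr p * (g (k + 1) / g k)"
      have xr: "x k * r = z0 * x (k + 1)"
        using gk by (simp add: r_def xk xk1 tz[symmetric])
      have "x k * (c + m * (r - z0)) = c * x k + m * (x k * r) - m * z0 * x k"
        by (simp add: algebra_simps)
      also have "\<dots> = c * x k + m * z0 * (x (k + 1) - x k)"
        unfolding xr by (simp add: algebra_simps)
      finally show ?thesis by (simp only: r_def)
    qed
    ultimately show ?thesis by simp
  qed
  have k2: "0 < 2 * \<kappa>\<^sup>2" using kappa by simp
  have S: "(\<Sum>k\<in>{-int N..<int N}. s k) \<le> e / (2 * \<kappa>\<^sup>2)" for N :: nat
  proof -
    have "ennreal (2 * \<kappa>\<^sup>2 * (\<Sum>k\<in>{-int N..<int N}. s k)) \<le> ennreal e"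
      using energy_lower_bound[OF levy p almost_dec kappa u t(1) _ fin, of "{-int N..<int N}"] E
      by (simp add: s_def a_def e_def less_top)
    then have "2 * \<kappa>\<^sup>2 * (\<Sum>k\<in>{-int N..<int N}. s k) \<le> e" by (simp add: e_def)
    then show ?thesis using k2 by (simp add: field_simps)
  qed
  have transport: "c * (\<Sum>k\<in>{-int N..<int N}. x k) \<le> e / (2 * \<kappa>\<^sup>2)" for N :: nat
    by (rule discrete_transport[OF x0 _ c _ s S]) (use bdd m z0 in \<open>auto simp: x_def\<close>)
  \<comment> \<open>Chosen so that the scale \<open>t * X powr (1 / p)\<close> of
    \<open>modular_le_one\<close> is \<open>l\<close>; it is positive even for zero energy.\<close>
  define X where "X = (l / t) powr p"
  have X: "0 < X" using l tp by (simp add: X_def)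
  note C = C_const_bounds[OF t]
  have eX: "e / (2 * \<kappa>\<^sup>2 * c) \<le> X"
  proof -
    \<comment> \<open>The bracket in \<open>Theta_const\<close>, so that
      \<open>q powr (- 1 / p)\<close> is
      \<open>Theta_const p \<kappa> \<theta> \<phi> t / t\<close>. Since
      \<open>0 < C_const p t \<le> 1\<close>, passing to the denominator \<open>q\<close> only
      enlarges the quotient.\<close>
    define q where "q = 2 * \<kappa>\<^sup>2 * C_const p t * c"
    have q: "0 < q" using k2 C c by (simp add: q_def)
    have e0: "0 \<le> e" by (simp add: e_def)
    have "e / (2 * \<kappa>\<^sup>2 * c) \<le> e / q"
      using C k2 c e0 q mult_left_le[of "C_const p t" "2 * \<kappa>\<^sup>2 * c"]
      by (intro divide_left_mono) (auto simp: q_def mult_ac)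
    also have "e / q = (q powr (- 1 / p) * e powr (1 / p)) powr p"
    proof -
      have "(q powr (- 1 / p)) powr p = q powr (- 1)" "(e powr (1 / p)) powr p = e"
        using e0 p by (simp_all add: powr_powr)
      then show ?thesis using q e0 by (simp add: powr_mult powr_minus divide_inverse)
    qed
    also have "\<dots> \<le> (l / t) powr p"
    proof (rule powr_mono2)
      show "q powr (- 1 / p) * e powr (1 / p) \<le> l / t"
        using l tp by (simp add: Theta_const_def q_def e_def c_def field_simps)
    qed (use p in auto)
    finally show ?thesis by (simp add: X_def)
  qed
  have "(\<Sum>k\<in>{-int N..<int N}. x k) \<le> X" for N :: nat
  proof -
    have "(\<Sum>k\<in>{-int N..<int N}. x k) \<le> e / (2 * \<kappa>\<^sup>2 * c)"
      using transport[of N] c k2 by (simp add: field_simps)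
    with eX show ?thesis by simp
  qed
  then have "orlicz_modular (extend_infty \<phi>) u (t * X powr (1 / p)) \<le> 1"
    using t by (intro modular_le_one[OF u _ fin X]) (auto simp: x_def a_def)
  also have "t * X powr (1 / p) = l" using l tp p by (simp add: X_def powr_powr)
  finally show ?thesis .
qed

lemma luxemburg_le_energy:
  fixes u :: "'a \<Rightarrow> real"
  assumes u: "u \<in> borel_measurable lebesgue" and t: "2 \<le> t" "p = 1 \<longrightarrow> 2 < t"
    and fin: "\<And>k. emeasure lebesgue {x. level t k < \<bar>u x\<bar>} < \<infinity>"
  defines "a \<equiv> \<lambda>k. measure lebesgue {x. level t k < \<bar>u x\<bar>}"
  assumes bdd: "\<And>k. k \<le> 0 \<Longrightarrow> level t k powr p * (a k * kernel_tail \<nu> (a k)) \<le> B"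
  shows "luxemburg_norm (extend_infty \<phi>) u \<le>
    ennreal (Theta_const p \<kappa> \<theta> \<phi> t) * ennreal_powr (nonlocal_energy p \<nu> u) (1 / p)"
proof (cases "nonlocal_energy p \<nu> u = \<infinity>")
  case True
  \<comment> \<open>Positivity of the constant rules out the value
    \<open>0 * \<infinity> = 0\<close> on the right.\<close>
  then show ?thesis using Theta_const_pos[OF t] by (simp add: ennreal_powr_def ennreal_mult_top)
next
  case False
  define L where "L = Theta_const p \<kappa> \<theta> \<phi> t * enn2real (nonlocal_energy p \<nu> u) powr (1 / p)"
  have L: "0 \<le> L" using Theta_const_pos[OF t] by (simp add: L_def)
  have "luxemburg_norm (extend_infty \<phi>) u \<le> ennreal L"
  proof (rule ennreal_le_epsilon)
    fix \<epsilon> :: real assume "0 < \<epsilon>"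
    then have "orlicz_modular (extend_infty \<phi>) u (L + \<epsilon>) \<le> 1"
      using False L bdd
      by (intro modular_le_one_of_energy[OF u t fin, of B]) (auto simp: L_def a_def less_top)
    then have "luxemburg_norm (extend_infty \<phi>) u \<le> ennreal (L + \<epsilon>)"
      unfolding luxemburg_norm_def using L \<open>0 < \<epsilon>\<close>
      by (intro Inf_lower CollectI exI[of _ "L + \<epsilon>"] conjI refl) auto
    then show "luxemburg_norm (extend_infty \<phi>) u \<le> ennreal L + ennreal \<epsilon>"
      using L \<open>0 < \<epsilon>\<close> by (simp add: ennreal_plus)
  qed
  also have "ennreal L = ennreal (Theta_const p \<kappa> \<theta> \<phi> t) * ennreal_powr (nonlocal_energy p \<nu> u) (1 / p)"
    using False Theta_const_pos[OF t] by (simp add: L_def ennreal_powr_def ennreal_mult)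
  finally show ?thesis .
qed

end

section \<open>Chebyshev's inequality, powers of extended reals, finite Luxemburg norm\<close>

lemma chebyshev_nn_integral:
  assumes "A \<in> sets M" "\<And>x. x \<in> A \<Longrightarrow> c \<le> F x"
  shows "c * emeasure M A \<le> (\<integral>\<^sup>+x. F x \<partial>M)"
proof -
  have "c * emeasure M A = (\<integral>\<^sup>+x. c * indicator A x \<partial>M)"
    using assms by (simp add: nn_integral_cmult_indicator)
  also have "\<dots> \<le> (\<integral>\<^sup>+x. F x \<partial>M)"
    using assms by (intro nn_integral_mono) (auto simp: indicator_def)
  finally show ?thesis .
qed

lemma ennreal_powr_mono: "0 \<le> a \<Longrightarrow> x \<le> y \<Longrightarrow> ennreal_powr x a \<le> ennreal_powr y a"
  unfolding ennreal_powr_def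
  by (auto simp: top_unique less_top intro!: ennreal_leI powr_mono2 enn2real_mono)

lemma ennreal_powr_less_top: "x < \<infinity> \<Longrightarrow> ennreal_powr x a < \<infinity>"
  by (auto simp: ennreal_powr_def)

text \<open>The infimum of the empty set is \<open>\<infinity>\<close>, so a finite norm supplies an
  admissible scale. In the embeddings, membership in the Orlicz space is obtained this way.\<close>

lemma luxemburg_finite_imp_orlicz:
  assumes "u \<in> borel_measurable lebesgue" "luxemburg_norm \<Phi> u < \<infinity>"
  shows "u \<in> orlicz_space \<Phi>"
proof -
  have "{ennreal l | l. 0 < l \<and> orlicz_modular \<Phi> u l \<le> 1} \<noteq> {}"
  proof
    assume "{ennreal l | l. 0 < l \<and> orlicz_modular \<Phi> u l \<le> 1} = {}"
    then have "luxemburg_norm \<Phi> u = Inf {}" unfolding luxemburg_norm_def by (rule arg_cong)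
    with assms(2) show False by simp
  qed
  then obtain l where "0 < l" "orlicz_modular \<Phi> u l \<le> 1" by auto
  then have "0 < l \<and> orlicz_modular \<Phi> u l < \<infinity>" using le_less_trans[OF _ ennreal_one_less_top] by auto
  with assms(1) show ?thesis unfolding orlicz_space_def by auto
qed

section \<open>A priori bounds on level sets, and the embedding criterion\<close>

context potential_setting
begin

text \<open>Chebyshev bounds \<open>\<phi> (level t k / l) * a k\<close> by \<open>M\<close>. Moving
  the factor \<open>1 / M\<close> inside \<open>\<psi>\<close> and comparing with
  \<open>psi_inverse\<close> removes \<open>\<psi>\<close> from both sides and leaves a bound on the
  p-th power of the level times \<open>a k * kernel_tail \<nu> (a k)\<close>.\<close>

lemma orlicz_level_sets:
  assumes uO: "u \<in> orlicz_space (extend_infty \<phi>)" and t: "1 < t"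
  defines "a \<equiv> \<lambda>k. measure lebesgue {x. level t k < \<bar>u x\<bar>}"
  shows "\<And>k. emeasure lebesgue {x. level t k < \<bar>u x\<bar>} < \<infinity>"
    and "\<exists>B. \<forall>k. level t k powr p * (a k * kernel_tail \<nu> (a k)) \<le> B"
proof -
  from uO obtain l where u: "u \<in> borel_measurable lebesgue" and l: "0 < l"
    and fin: "orlicz_modular (extend_infty \<phi>) u l < \<infinity>"
    unfolding orlicz_space_def by auto
  \<comment> \<open>At least \<open>1\<close>, so that \<open>1 / M\<close> is an admissible weight
    for \<open>psi_scale\<close>.\<close>
  define M where "M = max 1 (enn2real (orlicz_modular (extend_infty \<phi>) u l))"
  have M: "1 \<le> M" "orlicz_modular (extend_infty \<phi>) u l \<le> ennreal M"
  proof -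
    have "orlicz_modular (extend_infty \<phi>) u l = ennreal (enn2real (orlicz_modular (extend_infty \<phi>) u l))"
      using fin by (simp add: less_top)
    also have "\<dots> \<le> ennreal M" unfolding M_def by (intro ennreal_leI) simp
    finally show "orlicz_modular (extend_infty \<phi>) u l \<le> ennreal M" .
  qed (simp add: M_def)
  have cheb: "ennreal (\<phi> (level t k / l)) * emeasure lebesgue {x. level t k < \<bar>u x\<bar>} \<le> ennreal M" for k
  proof -
    have "ennreal (\<phi> (level t k / l)) * emeasure lebesgue {x. level t k < \<bar>u x\<bar>} \<le> orlicz_modular (extend_infty \<phi>) u l"
      unfolding orlicz_modular_def
      using l t by (intro chebyshev_nn_integral level_set_lebesgue[OF u])
        (auto simp: extend_infty_def intro!: ennreal_leI phi_mono divide_right_mono intro: less_imp_le)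
    also note M(2)
    finally show ?thesis .
  qed
  have ppos: "0 < \<phi> (level t k / l)" for k using t l by (intro phi_pos) auto
  show finite: "emeasure lebesgue {x. level t k < \<bar>u x\<bar>} < \<infinity>" for k
    using cheb[of k] ppos[of k] by (auto simp: less_top[symmetric] ennreal_mult_top top_unique)
  have "level t k powr p * (a k * kernel_tail \<nu> (a k)) \<le> M * l powr p" for k
  proof (cases "a k = 0")
    case False
    then have ak: "0 < a k" by (simp add: a_def zero_less_measure_iff)
    have lp: "0 < level t k" using t by simp
    have "ennreal (\<phi> (level t k / l) * a k) \<le> ennreal M"
      using cheb[of k] finite[of k] ppos[of k] by (simp add: a_def emeasure_eq_ennreal_measure ennreal_mult)
    then have "\<phi> (level t k / l) * a k \<le> M" using M by simp
    then have 1: "1 / M * \<phi> (level t k / l) \<le> 1 / a k" using M ak by (simp add: field_simps)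
    let ?y = "1 / M * (level t k / l) powr p"
    let ?g = "a k * kernel_tail \<nu> (a k)"
    have g: "0 < ?g" using ak kernel_tail_pos[OF ak] by simp
    have "\<psi> ?y \<le> 1 / M * \<psi> ((level t k / l) powr p)" using M by (intro psi_scale) auto
    also have "\<dots> = 1 / M * \<phi> (level t k / l)" using lp l by (simp add: phi_psi)
    also have "\<dots> \<le> \<psi> (1 / ?g)" using 1 by (simp add: psi_inverse[OF ak])
    finally have "?y \<le> 1 / ?g" using psi_strict_mono[of "1 / ?g" ?y] g by (cases "?y \<le> 1 / ?g") auto
    then have "(level t k / l) powr p * ?g \<le> M" using M g by (simp add: field_simps)
    moreover have "(level t k / l) powr p = level t k powr p / l powr p" using lp l by (simp add: powr_divide)
    ultimately show ?thesis using l by (simp add: field_simps)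
  qed (use M in simp)
  then show "\<exists>B. \<forall>k. level t k powr p * (a k * kernel_tail \<nu> (a k)) \<le> B" by blast
qed

text \<open>Chebyshev bounds the p-th power of the level times \<open>a k\<close>, but the tail may
  blow up where \<open>a k\<close> is small. Hence the restriction to \<open>k \<le> 0\<close>:
  below some \<open>j\<close> with \<open>a j > 0\<close> the measures only grow, so the tail is at
  most its value at \<open>a j\<close>, and the finitely many levels from \<open>j\<close> to
  \<open>0\<close> are bounded by their sum.\<close>

lemma lp_level_sets:
  fixes u :: "'a \<Rightarrow> real"
  assumes uL: "u \<in> lp_space p" and t: "1 < t"
  defines "a \<equiv> \<lambda>k. measure lebesgue {x. level t k < \<bar>u x\<bar>}"
  shows "\<And>k. emeasure lebesgue {x. level t k < \<bar>u x\<bar>} < \<infinity>"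
    and "\<exists>B. \<forall>k\<le>0. level t k powr p * (a k * kernel_tail \<nu> (a k)) \<le> B"
proof -
  from uL have u: "u \<in> borel_measurable lebesgue" and fin: "lp_energy p u < \<infinity>"
    unfolding lp_space_def by auto
  define U where "U = enn2real (lp_energy p u)"
  have U: "lp_energy p u = ennreal U" "0 \<le> U" using fin by (auto simp: U_def less_top)
  have cheb: "ennreal (level t k powr p) * emeasure lebesgue {x. level t k < \<bar>u x\<bar>} \<le> ennreal U" for k
    unfolding U(1)[symmetric] lp_energy_def using t p
    by (intro chebyshev_nn_integral level_set_lebesgue[OF u])
      (auto intro!: ennreal_leI powr_mono2 intro: less_imp_le)
  have lp: "0 < level t k powr p" for k
    using level_pos[of t k] t by (metis less_trans powr_gt_zero less_irrefl zero_less_one)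
  show finite: "emeasure lebesgue {x. level t k < \<bar>u x\<bar>} < \<infinity>" for k
    using cheb[of k] lp[of k] by (auto simp: less_top[symmetric] ennreal_mult_top top_unique)
  have cheb': "level t k powr p * a k \<le> U" for k
  proof -
    have "ennreal (level t k powr p * a k) \<le> ennreal U"
      using cheb[of k] finite[of k] lp[of k] by (simp add: a_def emeasure_eq_ennreal_measure ennreal_mult)
    then show ?thesis using U by simp
  qed
  have a0: "0 \<le> a k" for k by (simp add: a_def)
  have amono: "a k \<le> a j" if "j \<le> k" for j k
  proof -
    have "{x. level t k < \<bar>u x\<bar>} \<in> lmeasurable" for k
      using finite u by (intro fmeasurableI level_set_lebesgue) auto
    moreover have "level t j \<le> level t k" using t that by (intro level_mono) auto
    ultimately show ?thesis unfolding a_def by (intro measure_mono_fmeasurable) (auto dest: fmeasurableD)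
  qed
  define x where "x k = level t k powr p * (a k * kernel_tail \<nu> (a k))" for k
  have x0: "0 \<le> x k" for k
    using a0[of k] kernel_tail_pos[of "a k"] by (cases "a k = 0") (auto simp: x_def)
  show "\<exists>B. \<forall>k\<le>0. level t k powr p * (a k * kernel_tail \<nu> (a k)) \<le> B"
  proof (cases "\<forall>k\<le>0. a k = 0")
    case False
    then obtain j where j: "j \<le> 0" "0 < a j" using a0 by (metis less_eq_real_def)
    have "x k \<le> U * kernel_tail \<nu> (a j) + (\<Sum>i\<in>{j..0}. x i)" if "k \<le> 0" for k
    proof (cases "k \<le> j")
      case True
      have ak: "0 < a k" using amono[OF True] j by simp
      have "x k = level t k powr p * a k * kernel_tail \<nu> (a k)" by (simp add: x_def)
      also have "\<dots> \<le> U * kernel_tail \<nu> (a j)"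
        using cheb'[of k] U amono[OF True] j kernel_tail_pos[OF ak]
        by (intro mult_mono kernel_tail_antimono[OF levy p]) auto
      finally show ?thesis using sum_nonneg[of "{j..0}" x] x0 by simp
    next
      case False
      then have "x k \<le> (\<Sum>i\<in>{j..0}. x i)" using that x0 by (intro member_le_sum) auto
      moreover have "0 \<le> U * kernel_tail \<nu> (a j)" using U kernel_tail_pos[OF j(2)] by simp
      ultimately show ?thesis by simp
    qed
    then show ?thesis unfolding x_def by blast
  qed (auto intro!: exI[of _ 0])
qed

lemma luxemburg_le_energy_orlicz:
  assumes "2 \<le> t" "p = 1 \<longrightarrow> 2 < t" "u \<in> orlicz_space (extend_infty \<phi>)"
  shows "luxemburg_norm (extend_infty \<phi>) u \<le>
    ennreal (Theta_const p \<kappa> \<theta> \<phi> t) * ennreal_powr (nonlocal_energy p \<nu> u) (1 / p)"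
proof -
  have "u \<in> borel_measurable lebesgue" using assms by (auto simp: orlicz_space_def)
  moreover obtain B where "\<forall>k. level t k powr p * (measure lebesgue {x. level t k < \<bar>u x\<bar>}
      * kernel_tail \<nu> (measure lebesgue {x. level t k < \<bar>u x\<bar>})) \<le> B"
    using orlicz_level_sets(2)[OF assms(3), of t] assms(1) by auto
  moreover have "emeasure lebesgue {x. level t k < \<bar>u x\<bar>} < \<infinity>" for k
    using orlicz_level_sets(1)[OF assms(3), of t] assms(1) by auto
  ultimately show ?thesis using assms by (intro luxemburg_le_energy[where B=B]) auto
qed

lemma luxemburg_le_energy_lp:
  assumes "2 \<le> t" "p = 1 \<longrightarrow> 2 < t" "u \<in> lp_space p"
  shows "luxemburg_norm (extend_infty \<phi>) u \<le>
    ennreal (Theta_const p \<kappa> \<theta> \<phi> t) * ennreal_powr (nonlocal_energy p \<nu> u) (1 / p)"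
proof -
  have "u \<in> borel_measurable lebesgue" using assms by (auto simp: lp_space_def)
  moreover obtain B where "\<forall>k\<le>0. level t k powr p * (measure lebesgue {x. level t k < \<bar>u x\<bar>}
      * kernel_tail \<nu> (measure lebesgue {x. level t k < \<bar>u x\<bar>})) \<le> B"
    using lp_level_sets(2)[OF assms(3), of t] assms(1) by auto
  moreover have "emeasure lebesgue {x. level t k < \<bar>u x\<bar>} < \<infinity>" for k
    using lp_level_sets(1)[OF assms(3), of t] assms(1) by auto
  ultimately show ?thesis using assms by (intro luxemburg_le_energy[where B=B]) auto
qed

text \<open>Elements of \<open>X\<close> are only known to lie in \<open>L^p\<close>, so the
  \<open>L^p\<close> form of the inequality is applied; the resulting finite norm then puts them
  into the Orlicz space.\<close>

lemma embedding_of_energy_bound: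
  assumes XL: "X \<subseteq> lp_space p"
    and fin: "\<And>u. u \<in> X \<Longrightarrow> nonlocal_energy p \<nu> u < \<infinity>"
    and C: "0 < C" and bound: "\<And>u. u \<in> X \<Longrightarrow> ennreal_powr (nonlocal_energy p \<nu> u) (1 / p) \<le> ennreal C * normX u"
  shows "continuously_embedded X normX (orlicz_space (extend_infty \<phi>)) (luxemburg_norm (extend_infty \<phi>))"
proof -
  \<comment> \<open>A value of \<open>t\<close> that is admissible for every \<open>p\<close>,
    including \<open>p = 1\<close>.\<close>
  define T where "T = Theta_const p \<kappa> \<theta> \<phi> 3"
  have T: "0 < T" unfolding T_def by (rule Theta_const_pos) auto
  have le: "luxemburg_norm (extend_infty \<phi>) u \<le> ennreal T * ennreal_powr (nonlocal_energy p \<nu> u) (1 / p)"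
    if "u \<in> X" for u
    unfolding T_def using that XL by (intro luxemburg_le_energy_lp) auto
  have "u \<in> orlicz_space (extend_infty \<phi>)" if "u \<in> X" for u
  proof (rule luxemburg_finite_imp_orlicz)
    show "u \<in> borel_measurable lebesgue" using that XL by (auto simp: lp_space_def)
    show "luxemburg_norm (extend_infty \<phi>) u < \<infinity>"
      using le[OF that] ennreal_powr_less_top[OF fin[OF that], of "1 / p"]
      by (auto simp: ennreal_mult_less_top intro: le_less_trans)
  qed
  moreover have "luxemburg_norm (extend_infty \<phi>) u \<le> ennreal (T * C) * normX u" if "u \<in> X" for u
  proof -
    have "luxemburg_norm (extend_infty \<phi>) u \<le> ennreal T * (ennreal C * normX u)"
      using le[OF that] bound[OF that] by (rule order_trans[OF _ mult_left_mono]) simp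
    then show ?thesis using T C by (simp add: ennreal_mult mult.assoc)
  qed
  ultimately show ?thesis
    unfolding continuously_embedded_def using T C by (auto intro!: exI[of _ "T * C"])
qed

lemma nonlocal_sobolev_embedding:
  "continuously_embedded (nonlocal_sobolev_space p \<nu>) (nonlocal_sobolev_norm p \<nu>)
    (orlicz_space (extend_infty \<phi>)) (luxemburg_norm (extend_infty \<phi>))"
proof (rule embedding_of_energy_bound[of _ 1])
  fix u :: "'a \<Rightarrow> real"
  show "ennreal_powr (nonlocal_energy p \<nu> u) (1 / p) \<le> ennreal 1 * nonlocal_sobolev_norm p \<nu> u"
    using p by (auto simp: nonlocal_sobolev_norm_def intro!: ennreal_powr_mono)
qed (auto simp: nonlocal_sobolev_space_def)

end

subsection \<open>Smooth bumps\<close>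

lemma ck_function_differentiable: "ck_function (Suc k) f \<Longrightarrow> f differentiable (at x)"
  by simp

text \<open>Serves the product rule: the derivative of a product contains undifferentiated factors,
  which must count as functions of the lower order.\<close>

lemma ck_function_Suc: "ck_function (Suc k) f \<Longrightarrow> ck_function k f"
proof (induction k arbitrary: f)
  case 0
  then show ?case
    by (auto simp: continuous_on_eq_continuous_within intro: differentiable_imp_continuous_within)
next
  case (Suc k)
  from Suc.prems have "\<forall>b\<in>Basis. ck_function (Suc k) (\<lambda>x. frechet_derivative f (at x) b)"
    by (subst (asm) ck_function.simps) blast
  with Suc.IH have "\<forall>b\<in>Basis. ck_function k (\<lambda>x. frechet_derivative f (at x) b)" by blast
  moreover have "\<forall>x. f differentiable (at x)" using Suc.prems ck_function_differentiable by blast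
  ultimately show ?case by simp
qed

lemma ck_function_add:
  "ck_function k f \<Longrightarrow> ck_function k g \<Longrightarrow> ck_function k (\<lambda>x. f x + g x)"
proof (induction k arbitrary: f g)
  case (Suc k)
  have D: "frechet_derivative (\<lambda>x. f x + g x) (at x) = (\<lambda>h. frechet_derivative f (at x) h + frechet_derivative g (at x) h)" for x
    using Suc.prems by (intro frechet_derivative_at[symmetric] has_derivative_add)
      (auto simp: frechet_derivative_works[symmetric])
  show ?case using Suc by (auto simp: D intro: differentiable_add)
qed (auto intro: continuous_on_add)

lemma ck_function_mult:
  "ck_function k f \<Longrightarrow> ck_function k g \<Longrightarrow> ck_function k (\<lambda>x. f x * g x)"
proof (induction k arbitrary: f g)
  case (Suc k)
  have D: "frechet_derivative (\<lambda>x. f x * g x) (at x) = (\<lambda>h. f x * frechet_derivative g (at x) h + frechet_derivative f (at x) h * g x)" for x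
    using Suc.prems by (intro frechet_derivative_at[symmetric] has_derivative_mult)
      (auto simp: frechet_derivative_works[symmetric])
  have "ck_function k f" "ck_function k g" using Suc.prems ck_function_Suc by blast+
  then show ?case using Suc by (auto simp: D intro!: differentiable_mult ck_function_add)
qed (auto intro: continuous_on_mult)

lemma ck_function_const: "ck_function k (\<lambda>x. c)"
  by (induction k arbitrary: c) auto

lemma ck_function_prod:
  "finite I \<Longrightarrow> (\<And>i. i \<in> I \<Longrightarrow> ck_function k (f i)) \<Longrightarrow> ck_function k (\<lambda>x. \<Prod>i\<in>I. f i x)"
  by (induction I rule: finite_induct) (auto intro: ck_function_const ck_function_mult)

lemma frechet_derivative_translate:
  fixes f :: "'a::real_normed_vector \<Rightarrow> 'b::real_normed_vector"
  assumes "f differentiable (at (x - c))"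
  shows "((\<lambda>x. f (x - c)) has_derivative frechet_derivative f (at (x - c))) (at x)"
    and "frechet_derivative (\<lambda>x. f (x - c)) (at x) = frechet_derivative f (at (x - c))"
proof -
  show *: "((\<lambda>x. f (x - c)) has_derivative frechet_derivative f (at (x - c))) (at x)"
    using assms unfolding frechet_derivative_works
    by (rule has_derivative_compose[of "\<lambda>x. x - c" "\<lambda>h. h", rotated]) (auto intro!: derivative_eq_intros)
  then show "frechet_derivative (\<lambda>x. f (x - c)) (at x) = frechet_derivative f (at (x - c))"
    by (rule frechet_derivative_at[symmetric])
qed

lemma ck_function_translate: "ck_function k f \<Longrightarrow> ck_function k (\<lambda>x. f (x - c))"
proof (induction k arbitrary: f)
  case 0
  then have "continuous_on UNIV f" by simp
  then show ?case by (auto intro!: continuous_on_compose2[of UNIV f] continuous_intros)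
next
  case (Suc k)
  have df: "f differentiable (at x)" for x using Suc.prems by simp
  then have "frechet_derivative (\<lambda>x. f (x - c)) (at x) = frechet_derivative f (at (x - c))" for x
    by (intro frechet_derivative_translate)
  moreover have "(\<lambda>x. f (x - c)) differentiable (at x)" for x
    using frechet_derivative_translate(1)[OF df] by (rule differentiableI)
  moreover have "ck_function k (\<lambda>x. frechet_derivative f (at (x - c)) b)" if "b \<in> Basis" for b
    using Suc.IH[of "\<lambda>x. frechet_derivative f (at x) b"] Suc.prems that by simp
  ultimately show ?case by simp
qed

lemma test_function_translate:
  fixes \<psi> :: "'a::euclidean_space \<Rightarrow> real"
  assumes "test_function \<psi>"
  shows "test_function (\<lambda>x. \<psi> (x - c))"
proof -
  have "{x. \<psi> (x - c) \<noteq> 0} = (+) c ` {x. \<psi> x \<noteq> 0}"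
    by (auto simp: image_iff intro!: exI[of _ "_ - c"])
  then have "closure {x. \<psi> (x - c) \<noteq> 0} = (+) c ` closure {x. \<psi> x \<noteq> 0}"
    by (simp add: closure_translation)
  with assms show ?thesis
    by (simp add: test_function_def ck_function_translate compact_translation)
qed

(* The functions P(1/r) exp(-1/r), extended by 0 to r <= 0, are closed under differentiation. *)
definition flat :: "real poly \<Rightarrow> real \<Rightarrow> real" where
  "flat P r = (if 0 < r then poly P (1 / r) * exp (- (1 / r)) else 0)"

lemma poly_exp_decay: "((\<lambda>s. poly P s * exp (- s)) \<longlongrightarrow> (0::real)) at_top"
proof -
  have "((\<lambda>s. \<Sum>i\<le>degree P. coeff P i * (s ^ i / exp s)) \<longlongrightarrow> (\<Sum>i\<le>degree P. coeff P i * 0)) at_top"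
    by (intro tendsto_intros tendsto_power_div_exp_0)
  then show ?thesis
    by (simp add: poly_altdef exp_minus divide_inverse sum_distrib_right mult.assoc)
qed

text \<open>In the variable \<open>s = 1/r\<close> one has d/dr = - s^2 d/ds, and the s-derivative
  of \<open>P(s) exp(-s)\<close> is \<open>(P'(s) - P(s)) exp(-s)\<close>; hence the polynomial s^2
  (P - P'). At \<open>r = 0\<close> the right difference quotient is \<open>s P(s) exp(-s)\<close>
  and decays as \<open>s\<close> grows.\<close>

lemma flat_has_derivative:
  "(flat P has_real_derivative flat ([:0, 0, 1:] * (P - pderiv P)) r) (at r)"
proof -
  let ?Q = "[:0, 0, 1:] * (P - pderiv P)"
  consider "0 < r" | "r < 0" | "r = 0" by linarith
  then show ?thesis
  proof cases
    case 1
    have "((\<lambda>r. poly P (1 / r) * exp (- (1 / r))) has_real_derivative flat ?Q r) (at r)"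
      using 1 by (auto intro!: derivative_eq_intros DERIV_chain2[OF poly_DERIV]
          simp: flat_def field_simps power2_eq_square)
    then show ?thesis
      by (rule has_field_derivative_transform_within_open[of _ _ _ "{0<..}"])
        (use 1 in \<open>auto simp: flat_def\<close>)
  next
    case 2
    have "((\<lambda>r. 0) has_real_derivative flat ?Q r) (at r)" using 2 by (simp add: flat_def)
    then show ?thesis
      by (rule has_field_derivative_transform_within_open[of _ _ _ "{..<0}"])
        (use 2 in \<open>auto simp: flat_def\<close>)
  next
    case 3
    have "((\<lambda>h. (\<lambda>s. poly ([:0, 1:] * P) s * exp (- s)) (inverse h)) \<longlongrightarrow> 0) (at_right 0)"
      by (rule filterlim_compose[OF poly_exp_decay filterlim_inverse_at_top_right])
    then have right: "((\<lambda>h. flat P h / h) \<longlongrightarrow> 0) (at_right 0)"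
      by (rule Lim_transform_eventually)
        (auto simp: flat_def divide_inverse eventually_at_filter)
    have left: "((\<lambda>h. flat P h / h) \<longlongrightarrow> 0) (at_left 0)"
      by (rule Lim_transform_eventually[OF tendsto_const])
        (auto simp: flat_def eventually_at_filter)
    have "((\<lambda>h. flat P h / h) \<longlongrightarrow> 0) (at 0)" by (rule filterlim_split_at[OF left right])
    then show ?thesis using 3 by (simp add: has_field_derivative_iff flat_def)
  qed
qed

lemma ck_function_flat: "ck_function k (\<lambda>x. flat P (x \<bullet> v + c))"
proof (induction k arbitrary: P)
  case 0
  have "continuous_on UNIV (flat P)"
    by (auto simp: continuous_on_eq_continuous_within intro: DERIV_isCont flat_has_derivative)
  then show ?case by (auto intro!: continuous_on_compose2[of UNIV "flat P"] continuous_intros)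
next
  case (Suc k)
  let ?Q = "[:0, 0, 1:] * (P - pderiv P)"
  have D: "((\<lambda>x. flat P (x \<bullet> v + c)) has_derivative (\<lambda>h. flat ?Q (x \<bullet> v + c) * (h \<bullet> v))) (at x)" for x
    by (rule has_derivative_compose[of "\<lambda>x. x \<bullet> v + c" "\<lambda>h. h \<bullet> v" _ _ "flat P",
        OF _ flat_has_derivative[unfolded has_field_derivative_def]])
      (auto intro!: derivative_eq_intros)
  have F: "frechet_derivative (\<lambda>x. flat P (x \<bullet> v + c)) (at x) = (\<lambda>h. flat ?Q (x \<bullet> v + c) * (h \<bullet> v))" for x
    using D by (rule frechet_derivative_at[symmetric])
  have "(\<lambda>x. flat P (x \<bullet> v + c)) differentiable (at x)" for x
    using D by (auto simp: differentiable_def)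
  moreover have "ck_function k (\<lambda>x. frechet_derivative (\<lambda>x. flat P (x \<bullet> v + c)) (at x) b)" for b
    unfolding F by (intro ck_function_mult Suc.IH ck_function_const)
  ultimately show ?case by simp
qed

text \<open>For \<open>n > 0\<close> each factor is \<open>exp(-1/r)\<close> with \<open>r\<close>
  equal to \<open>n\<close> times the distance of a coordinate to a face of the box, and
  \<open>0\<close> beyond that face. The affine form matches \<open>ck_function_flat\<close>; large
  \<open>n\<close> flattens the function to the indicator of the box.\<close>

definition bump :: "real \<Rightarrow> 'a::euclidean_space \<Rightarrow> 'a \<Rightarrow> 'a \<Rightarrow> real" where
  "bump n a c x = (\<Prod>b\<in>Basis. flat 1 (x \<bullet> (n *\<^sub>R b) + - n * (a \<bullet> b)) * flat 1 (x \<bullet> (- n *\<^sub>R b) + n * (c \<bullet> b)))"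

lemma flat_one_bounds: "0 \<le> flat 1 r" "flat 1 r \<le> 1" "flat 1 r \<noteq> 0 \<longleftrightarrow> 0 < r"
  by (auto simp: flat_def)

lemma bump_bounds: "0 \<le> bump n a c x" "bump n a c x \<le> 1"
  unfolding bump_def
  by (auto intro!: prod_nonneg prod_le_1 mult_nonneg_nonneg mult_le_one flat_one_bounds)

lemma bump_outside:
  assumes "0 < n" "x \<notin> box a c"
  shows "bump n a c x = 0"
proof -
  obtain b where b: "b \<in> Basis" "x \<bullet> b \<le> a \<bullet> b \<or> c \<bullet> b \<le> x \<bullet> b"
    using assms by (auto simp: mem_box not_less)
  then have "n * (x \<bullet> b) \<le> n * (a \<bullet> b) \<or> n * (c \<bullet> b) \<le> n * (x \<bullet> b)" using assms by auto
  then have "flat 1 (x \<bullet> (n *\<^sub>R b) + - n * (a \<bullet> b)) * flat 1 (x \<bullet> (- n *\<^sub>R b) + n * (c \<bullet> b)) = 0"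
    by (auto simp: flat_def)
  with b(1) show ?thesis unfolding bump_def by (intro prod_zero) auto
qed

lemma test_function_bump:
  assumes "0 < n"
  shows "test_function (bump n a c)"
proof -
  have "ck_function k (bump n a c)" for k
    unfolding bump_def[abs_def] by (intro ck_function_prod ck_function_mult ck_function_flat) auto
  moreover have "bounded {x. bump n a c x \<noteq> 0}"
    by (rule bounded_subset[OF bounded_box[of a c]]) (use bump_outside[OF assms] in blast)
  ultimately show ?thesis by (simp add: test_function_def compact_closure)
qed

lemma bump_tendsto: "(\<lambda>n. bump (real (Suc n)) a c x) \<longlonglongrightarrow> indicator (box a c) x"
proof (cases "x \<in> box a c")
  case True
  have lim: "(\<lambda>n. flat 1 (real (Suc n) * r)) \<longlonglongrightarrow> 1" if "0 < r" for r
  proof -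
    have "(\<lambda>n. exp (- (inverse (real (Suc n)) * inverse r))) \<longlonglongrightarrow> exp (- (0 * inverse r))"
      by (intro tendsto_intros LIMSEQ_inverse_real_of_nat)
    then show ?thesis using that by (simp add: flat_def divide_inverse mult.commute)
  qed
  have "(\<lambda>n. bump (real (Suc n)) a c x) \<longlonglongrightarrow> (\<Prod>b\<in>(Basis::'a set). 1 * 1)"
    unfolding bump_def
  proof (intro tendsto_prod tendsto_mult)
    fix b :: 'a assume b: "b \<in> Basis"
    with True have "0 < x \<bullet> b - a \<bullet> b" "0 < c \<bullet> b - x \<bullet> b" by (auto simp: mem_box)
    note lims = this[THEN lim]
    have shift: "x \<bullet> (m *\<^sub>R b) + - m * (a \<bullet> b) = m * (x \<bullet> b - a \<bullet> b)"
      "x \<bullet> (- m *\<^sub>R b) + m * (c \<bullet> b) = m * (c \<bullet> b - x \<bullet> b)" for m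
      by (simp_all add: algebra_simps)
    show "(\<lambda>n. flat 1 (x \<bullet> (real (Suc n) *\<^sub>R b) + - real (Suc n) * (a \<bullet> b))) \<longlonglongrightarrow> 1"
      "(\<lambda>n. flat 1 (x \<bullet> (- real (Suc n) *\<^sub>R b) + real (Suc n) * (c \<bullet> b))) \<longlonglongrightarrow> 1"
      unfolding shift by (rule lims)+
  qed
  with True show ?thesis by simp
qed (simp add: bump_outside)

text \<open>\<open>P\<close> and \<open>N\<close> are the positive and negative parts, as
  \<open>ennreal\<close> sends negative numbers to \<open>0\<close>. The measures with these
  densities are finite and equal on boxes, an intersection-stable generator, so they coincide;
  densities are unique almost everywhere.\<close>

lemma AE_zero_of_box_integrals:
  fixes F :: "'a::euclidean_space \<Rightarrow> real"
  assumes int: "\<And>a c. integrable lborel (\<lambda>x. indicator (box a c) x * F x)"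
    and F[measurable]: "F \<in> borel_measurable borel"
    and zero: "\<And>a c. (LINT x|lborel. indicator (box a c) x * F x) = 0"
  shows "AE x in lborel. F x = 0"
proof -
  define P N where "P x = ennreal (F x)" and "N x = ennreal (- F x)" for x
  have [measurable]: "P \<in> borel_measurable borel" "N \<in> borel_measurable borel"
    unfolding P_def N_def by measurable
  have eq: "emeasure (density lborel P) (box a c) = emeasure (density lborel N) (box a c)"
    and fin: "emeasure (density lborel P) (box a c) \<noteq> \<infinity>" for a c
  proof -
    let ?G = "\<lambda>x. indicator (box a c) x * F x"
    have 1: "emeasure (density lborel P) (box a c) = (\<integral>\<^sup>+x. ennreal (?G x) \<partial>lborel)"
      by (subst emeasure_density) (auto simp: P_def indicator_def intro!: nn_integral_cong)
    have 2: "emeasure (density lborel N) (box a c) = (\<integral>\<^sup>+x. ennreal (- ?G x) \<partial>lborel)"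
      by (subst emeasure_density) (auto simp: N_def indicator_def intro!: nn_integral_cong)
    have f: "(\<integral>\<^sup>+x. ennreal (?G x) \<partial>lborel) \<noteq> \<infinity>" "(\<integral>\<^sup>+x. ennreal (- ?G x) \<partial>lborel) \<noteq> \<infinity>"
      using int[of a c] by (auto simp: real_integrable_def)
    have "enn2real (\<integral>\<^sup>+x. ennreal (?G x) \<partial>lborel) = enn2real (\<integral>\<^sup>+x. ennreal (- ?G x) \<partial>lborel)"
      using zero[of a c] real_lebesgue_integral_def[OF int[of a c]] by simp
    then have "ennreal (enn2real (\<integral>\<^sup>+x. ennreal (?G x) \<partial>lborel)) = ennreal (enn2real (\<integral>\<^sup>+x. ennreal (- ?G x) \<partial>lborel))"
      by (rule arg_cong)
    then show "emeasure (density lborel P) (box a c) = emeasure (density lborel N) (box a c)"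
      unfolding 1 2 using f by (simp add: ennreal_enn2real_if)
    show "emeasure (density lborel P) (box a c) \<noteq> \<infinity>" unfolding 1 by (rule f(1))
  qed
  have "density lborel P = density lborel N"
  proof (rule measure_eqI_generator_eq)
    let ?E = "range (\<lambda>(a, b). box a b::'a set)"
    show "Int_stable ?E" by (auto simp: Int_stable_def box_Int_box)
    show "?E \<subseteq> Pow UNIV" "sets (density lborel P) = sigma_sets UNIV ?E" "sets (density lborel N) = sigma_sets UNIV ?E"
      by (simp_all add: borel_eq_box)
    let ?A = "\<lambda>n::nat. box (- (real n *\<^sub>R One)) (real n *\<^sub>R One) :: 'a set"
    show "range ?A \<subseteq> ?E" "(\<Union>i. ?A i) = UNIV" unfolding UN_box_eq_UNIV by auto
    show "emeasure (density lborel P) (?A i) \<noteq> \<infinity>" for i by (rule fin)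
    show "emeasure (density lborel P) X = emeasure (density lborel N) X" if "X \<in> ?E" for X
      using that eq by auto
  qed
  then have "AE x in lborel. P x = N x" by (intro sigma_finite_measure.density_unique[OF sigma_finite_lborel]) auto
  then show ?thesis
  proof eventually_elim
    case (elim x)
    then show ?case
      by (cases "0 \<le> F x") (auto simp: P_def N_def ennreal_neg ennreal_eq_0_iff)
  qed
qed

text \<open>The fundamental lemma of the calculus of variations: bumps tend to the indicator of a
  box, dominated by \<open>\<bar>F\<bar>\<close> on a ball, which reduces the claim to box
  integrals.\<close>

lemma AE_zero_of_test_functions:
  fixes F :: "'a::euclidean_space \<Rightarrow> real"
  assumes int: "\<And>r. integrable lborel (\<lambda>x. indicator (cball 0 r) x * F x)"
    and F[measurable]: "F \<in> borel_measurable borel"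
    and zero: "\<And>\<psi>. test_function \<psi> \<Longrightarrow> (LINT x|lborel. F x * \<psi> x) = 0"
  shows "AE x in lborel. F x = 0"
proof (rule AE_zero_of_box_integrals[OF _ F])
  fix a c :: 'a
  obtain r where r: "box a c \<subseteq> cball 0 r"
    using bounded_subset_ballD[OF bounded_box[of a c], of 0] ball_subset_cball by blast
  have [measurable]: "bump (real (Suc n)) a c \<in> borel_measurable borel" for n
    using test_function_bump[of "real (Suc n)" a c]
    by (intro borel_measurable_continuous_onI) (auto simp: test_function_def dest: spec[of _ 0])
  have lim: "(\<lambda>n. LINT x|lborel. F x * bump (real (Suc n)) a c x) \<longlonglongrightarrow> (LINT x|lborel. F x * indicator (box a c) x)"
    and i: "integrable lborel (\<lambda>x. F x * indicator (box a c) x)"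
  proof -
    have 1: "AE x in lborel. (\<lambda>n. F x * bump (real (Suc n)) a c x) \<longlonglongrightarrow> F x * indicator (box a c) x"
      by (intro AE_I2 tendsto_intros bump_tendsto)
    have 2: "AE x in lborel. norm (F x * bump (real (Suc n)) a c x) \<le> \<bar>indicator (cball 0 r) x * F x\<bar>" for n
    proof (rule AE_I2)
      fix x
      show "norm (F x * bump (real (Suc n)) a c x) \<le> \<bar>indicator (cball 0 r) x * F x\<bar>"
      proof (cases "x \<in> box a c")
        case True
        then have "x \<in> cball 0 r" using r by blast
        then show ?thesis using bump_bounds[of "real (Suc n)" a c x]
          by (simp add: abs_mult mult_left_le)
      qed (simp add: bump_outside)
    qed
    note dct = _ _ integrable_abs[OF int[of r]] 1 2
    show "(\<lambda>n. LINT x|lborel. F x * bump (real (Suc n)) a c x) \<longlonglongrightarrow> (LINT x|lborel. F x * indicator (box a c) x)"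
      by (rule integral_dominated_convergence[OF dct]) measurable
    show "integrable lborel (\<lambda>x. F x * indicator (box a c) x)"
      by (rule integrable_dominated_convergence[OF dct]) measurable
  qed
  have "(LINT x|lborel. F x * bump (real (Suc n)) a c x) = 0" for n
    by (intro zero test_function_bump) simp
  with lim have "(LINT x|lborel. F x * indicator (box a c) x) = 0"
    by (simp add: LIMSEQ_const_iff)
  then show "(LINT x|lborel. indicator (box a c) x * F x) = 0" by (simp add: mult.commute)
  show "integrable lborel (\<lambda>x. indicator (box a c) x * F x)" using i by (simp add: mult.commute)
qed

subsection \<open>Translates of Sobolev functions\<close>

lemma continuous_compact_support_bound:
  fixes f :: "'a::euclidean_space \<Rightarrow> real"
  assumes "continuous_on UNIV f" "compact K" "\<And>x. x \<notin> K \<Longrightarrow> f x = 0"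
  shows "\<exists>C R. 0 \<le> C \<and> (\<forall>x. \<bar>f x\<bar> \<le> C * indicator (cball 0 R) x)"
proof -
  have "compact (f ` K)"
    using assms by (intro compact_continuous_image continuous_on_subset[OF assms(1)]) auto
  then obtain C where C: "\<And>x. x \<in> K \<Longrightarrow> \<bar>f x\<bar> \<le> C"
    using compact_imp_bounded bounded_iff by (metis imageI real_norm_def)
  obtain R where R: "K \<subseteq> cball 0 R"
    using bounded_subset_ballD[OF compact_imp_bounded[OF assms(2)], of 0] ball_subset_cball by blast
  have "\<bar>f x\<bar> \<le> \<bar>C\<bar> * indicator (cball 0 R) x" for x
  proof (cases "x \<in> K")
    case True
    then have "\<bar>f x\<bar> \<le> \<bar>C\<bar>" "x \<in> cball 0 R" using C[of x] R by auto
    then show ?thesis by simp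
  next
    case False
    then show ?thesis by (simp add: assms(3))
  qed
  then show ?thesis by (intro exI[of _ "\<bar>C\<bar>"] exI[of _ R]) simp
qed

lemma test_function_differentiable: "test_function \<psi> \<Longrightarrow> \<psi> differentiable (at x)"
  unfolding test_function_def by (metis ck_function_differentiable)

lemma test_function_continuous: "test_function \<psi> \<Longrightarrow> continuous_on UNIV \<psi>"
  unfolding test_function_def by (metis ck_function.simps(1))

lemma frechet_derivative_expand:
  fixes \<psi> :: "'a::euclidean_space \<Rightarrow> real"
  assumes "\<psi> differentiable (at x)"
  shows "frechet_derivative \<psi> (at x) h = (\<Sum>b\<in>Basis. (h \<bullet> b) * frechet_derivative \<psi> (at x) b)"
proof -
  have l: "linear (frechet_derivative \<psi> (at x))"
    using assms unfolding frechet_derivative_works by (rule has_derivative_linear)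
  have "frechet_derivative \<psi> (at x) h = frechet_derivative \<psi> (at x) (\<Sum>b\<in>Basis. (h \<bullet> b) *\<^sub>R b)"
    by (simp add: euclidean_representation)
  also have "\<dots> = (\<Sum>b\<in>Basis. (h \<bullet> b) * frechet_derivative \<psi> (at x) b)"
    using l by (simp add: linear_sum linear_scale)
  finally show ?thesis .
qed

lemma test_function_derivative_continuous:
  fixes \<psi> :: "'a::euclidean_space \<Rightarrow> real"
  assumes "test_function \<psi>"
  shows "continuous_on UNIV (\<lambda>x. frechet_derivative \<psi> (at x) h)"
proof -
  have "ck_function (Suc 0) \<psi>" using assms by (simp only: test_function_def)
  then have "continuous_on UNIV (\<lambda>x. frechet_derivative \<psi> (at x) b)" if "b \<in> Basis" for b
    using that by simp
  then show ?thesis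
    unfolding frechet_derivative_expand[OF test_function_differentiable[OF assms], of _ h]
    by (intro continuous_intros) auto
qed

lemma test_function_derivative_support:
  fixes \<psi> :: "'a::euclidean_space \<Rightarrow> real"
  assumes "x \<notin> closure {x. \<psi> x \<noteq> 0}"
  shows "frechet_derivative \<psi> (at x) h = 0"
proof -
  have "((\<lambda>x. 0) has_derivative (\<lambda>h. 0)) (at x)" by simp
  then have "(\<psi> has_derivative (\<lambda>h. 0)) (at x)"
  proof (rule has_derivative_transform_within_open[of _ _ _ _ "- closure {x. \<psi> x \<noteq> 0}"])
    show "0 = \<psi> y" if "y \<in> - closure {x. \<psi> x \<noteq> 0}" for y
      using that closure_subset[of "{x. \<psi> x \<noteq> 0}"] by auto
  qed (use assms in auto)
  then show ?thesis using frechet_derivative_at by metis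
qed

lemma test_function_bounds:
  fixes \<psi> :: "'a::euclidean_space \<Rightarrow> real"
  assumes "test_function \<psi>"
  shows "\<exists>C R. 0 \<le> C \<and> (\<forall>x. \<bar>\<psi> x\<bar> \<le> C * indicator (cball 0 R) x)"
    and "\<exists>C R. 0 \<le> C \<and> (\<forall>x. \<bar>frechet_derivative \<psi> (at x) h\<bar> \<le> C * indicator (cball 0 R) x)"
proof -
  have K: "compact (closure {x. \<psi> x \<noteq> 0})" using assms by (simp add: test_function_def)
  have "\<psi> x = 0" if "x \<notin> closure {x. \<psi> x \<noteq> 0}" for x
    using that closure_subset[of "{x. \<psi> x \<noteq> 0}"] by auto
  then show "\<exists>C R. 0 \<le> C \<and> (\<forall>x. \<bar>\<psi> x\<bar> \<le> C * indicator (cball 0 R) x)"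
    by (intro continuous_compact_support_bound[OF test_function_continuous[OF assms] K])
  show "\<exists>C R. 0 \<le> C \<and> (\<forall>x. \<bar>frechet_derivative \<psi> (at x) h\<bar> \<le> C * indicator (cball 0 R) x)"
    by (intro continuous_compact_support_bound[OF test_function_derivative_continuous[OF assms] K]
        test_function_derivative_support)
qed

lemma integral_lborel_translate:
  fixes f :: "'a::euclidean_space \<Rightarrow> real"
  assumes [measurable]: "f \<in> borel_measurable borel"
  shows "(LINT x|lborel. f (t + x)) = (LINT x|lborel. f x)"
  by (subst (2) lborel_distr_plus[of t, symmetric]) (simp add: integral_distr)

lemma integrable_lborel_translate:
  fixes f :: "'a::euclidean_space \<Rightarrow> real"
  assumes "integrable lborel f"
  shows "integrable lborel (\<lambda>x. f (t + x))"
proof -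
  have "integrable (distr lborel borel ((+) t)) f" using assms by (simp add: lborel_distr_plus)
  then show ?thesis using assms by (subst (asm) integrable_distr_eq) auto
qed

text \<open>Justifies Fubini for line integrals. For \<open>s\<close> in the unit interval the shift
  by \<open>s *\<^sub>R k\<close> moves the support by at most \<open>norm k\<close>, so the
  integral in \<open>x\<close> is bounded independently of \<open>s\<close>. It is used with
  \<open>k = h\<close> on the gradient side and \<open>k = 0\<close> on the function side.\<close>

lemma line_integrable:
  fixes \<gamma> :: "'a::euclidean_space \<Rightarrow> real" and \<eta> :: "'a \<Rightarrow> real \<Rightarrow> real"
  assumes [measurable]: "\<gamma> \<in> borel_measurable borel"
    and loc: "\<And>r. integrable lborel (\<lambda>x. indicator (cball 0 r) x * \<gamma> x)"
    and chi[measurable]: "case_prod \<eta> \<in> borel_measurable (lborel \<Otimes>\<^sub>M lborel)"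
    and C: "0 \<le> C" and bound: "\<And>x s. s \<in> {0..1} \<Longrightarrow> \<bar>\<eta> x s\<bar> \<le> C * indicator (cball 0 R) x"
  shows "integrable (lborel \<Otimes>\<^sub>M lborel) (\<lambda>(x, s). indicator {0..1} s * (\<eta> x s * \<gamma> (x + s *\<^sub>R k)))"
proof (rule integrableI_bounded)
  show "(\<lambda>(x, s). indicator {0..1} s * (\<eta> x s * \<gamma> (x + s *\<^sub>R k))) \<in> borel_measurable (lborel \<Otimes>\<^sub>M lborel)"
    by measurable
  let ?R = "R + norm k"
  let ?B = "\<integral>\<^sup>+x. ennreal (C * \<bar>indicator (cball 0 ?R) x * \<gamma> x\<bar>) \<partial>lborel"
  have locm[measurable]: "(\<lambda>x. indicator (cball 0 ?R) x * \<gamma> x) \<in> borel_measurable borel"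
    using borel_measurable_integrable[OF loc[of ?R]] by simp
  have B: "?B < \<infinity>"
    using integrable_mult_right[OF integrable_abs[OF loc[of ?R]], of C]
    by (subst (asm) integrable_iff_bounded) (simp add: C abs_mult)
  have "(\<integral>\<^sup>+z. ennreal (norm (case z of (x, s) \<Rightarrow> indicator {0..1} s * (\<eta> x s * \<gamma> (x + s *\<^sub>R k)))) \<partial>(lborel \<Otimes>\<^sub>M lborel))
    = (\<integral>\<^sup>+s. (\<integral>\<^sup>+x. ennreal (norm (indicator {0..1} s * (\<eta> x s * \<gamma> (x + s *\<^sub>R k)))) \<partial>lborel) \<partial>lborel)"
    by (subst lborel_pair.nn_integral_snd[symmetric]) auto
  also have "\<dots> \<le> (\<integral>\<^sup>+s. ?B * indicator {0..1::real} s \<partial>lborel)"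
  proof (rule nn_integral_mono)
    fix s :: real
    show "(\<integral>\<^sup>+x. ennreal (norm (indicator {0..1} s * (\<eta> x s * \<gamma> (x + s *\<^sub>R k)))) \<partial>lborel) \<le> ?B * indicator {0..1} s"
    proof (cases "s \<in> {0..1}")
      case True
      have "(\<integral>\<^sup>+x. ennreal (norm (indicator {0..1} s * (\<eta> x s * \<gamma> (x + s *\<^sub>R k)))) \<partial>lborel)
          \<le> (\<integral>\<^sup>+x. ennreal (C * \<bar>indicator (cball 0 ?R) (s *\<^sub>R k + x) * \<gamma> (s *\<^sub>R k + x)\<bar>) \<partial>lborel)"
      proof (intro nn_integral_mono ennreal_leI)
        fix x
        have "norm (s *\<^sub>R k) \<le> norm k" using True by (simp add: mult_left_le_one_le)
        then have "norm (s *\<^sub>R k + x) \<le> norm k + norm x" using norm_triangle_ineq[of "s *\<^sub>R k" x] by linarith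
        then have "C * indicator (cball 0 R) x \<le> C * indicator (cball 0 ?R) (s *\<^sub>R k + x)"
          using C by (auto simp: indicator_def)
        then have "\<bar>\<eta> x s\<bar> \<le> C * indicator (cball 0 ?R) (s *\<^sub>R k + x)"
          using bound[OF True, of x] by linarith
        then have "\<bar>\<eta> x s\<bar> * \<bar>\<gamma> (s *\<^sub>R k + x)\<bar> \<le> C * indicator (cball 0 ?R) (s *\<^sub>R k + x) * \<bar>\<gamma> (s *\<^sub>R k + x)\<bar>"
          by (rule mult_right_mono) simp
        then show "norm (indicator {0..1} s * (\<eta> x s * \<gamma> (x + s *\<^sub>R k))) \<le> C * \<bar>indicator (cball 0 ?R) (s *\<^sub>R k + x) * \<gamma> (s *\<^sub>R k + x)\<bar>"
          using True by (simp add: abs_mult add.commute mult.assoc)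
      qed
      also have "\<dots> = ?B" by (rule nn_integral_lborel_translate) (use locm in measurable)
      finally show ?thesis using True by simp
    qed simp
  qed
  also have "\<dots> = ?B" by (simp add: nn_integral_cmult_indicator)
  also have "\<dots> < \<infinity>" by (rule B)
  finally show "(\<integral>\<^sup>+z. ennreal (norm (case z of (x, s) \<Rightarrow> indicator {0..1} s * (\<eta> x s * \<gamma> (x + s *\<^sub>R k)))) \<partial>(lborel \<Otimes>\<^sub>M lborel)) < \<infinity>" .
qed

lemma integrable_times_bounded_support:
  fixes \<gamma> \<psi> :: "'a::euclidean_space \<Rightarrow> real"
  assumes [measurable]: "\<gamma> \<in> borel_measurable borel" "\<psi> \<in> borel_measurable borel"
    and loc: "\<And>r. integrable lborel (\<lambda>x. indicator (cball 0 r) x * \<gamma> x)"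
    and bound: "\<And>x. \<bar>\<psi> x\<bar> \<le> C * indicator (cball 0 R) x"
  shows "integrable lborel (\<lambda>x. \<gamma> x * \<psi> x)"
proof (rule Bochner_Integration.integrable_bound[OF integrable_mult_right[OF integrable_abs[OF loc[of R]], of C]])
  show "AE x in lborel. norm (\<gamma> x * \<psi> x) \<le> norm (C * \<bar>indicator (cball 0 R) x * \<gamma> x\<bar>)"
  proof (rule AE_I2)
    fix x
    have "\<bar>\<gamma> x\<bar> * \<bar>\<psi> x\<bar> \<le> \<bar>\<gamma> x\<bar> * (C * indicator (cball 0 R) x)"
      by (intro mult_left_mono bound) simp
    also have "\<dots> = C * \<bar>indicator (cball 0 R) x * \<gamma> x\<bar>" by (simp add: abs_mult)
    also have "\<dots> \<le> norm \<dots>" by simp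
    finally show "norm (\<gamma> x * \<psi> x) \<le> norm (C * \<bar>indicator (cball 0 R) x * \<gamma> x\<bar>)"
      by (simp only: real_norm_def abs_mult)
  qed
qed measurable

text \<open>The calculus is moved to the test function. After shifting \<open>x\<close> by
  \<open>s *\<^sub>R h\<close>, the weak identity trades \<open>\<gamma>\<close> for the derivative
  of the translated \<open>\<psi>\<close>; integrating in \<open>s\<close> gives
  \<open>\<psi> x - \<psi> (x - h)\<close> by the fundamental theorem for smooth functions, and
  translating back gives the difference of \<open>v\<close>.\<close>

lemma translate_diff_eq_line_integral:
  fixes v \<gamma> :: "'a::euclidean_space \<Rightarrow> real"
  assumes [measurable]: "v \<in> borel_measurable borel" "\<gamma> \<in> borel_measurable borel"
    and locv: "\<And>r. integrable lborel (\<lambda>x. indicator (cball 0 r) x * v x)"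
    and locg: "\<And>r. integrable lborel (\<lambda>x. indicator (cball 0 r) x * \<gamma> x)"
    and weak: "\<And>\<psi>. test_function \<psi> \<Longrightarrow>
      (LINT x|lborel. v x * frechet_derivative \<psi> (at x) h) = - (LINT x|lborel. \<gamma> x * \<psi> x)"
  shows "AE x in lborel. v (h + x) - v x = (LINT s|lborel. indicator {0..1} s * \<gamma> (x + s *\<^sub>R h))"
proof -
  define G where "G x = (LINT s|lborel. indicator {0..1} s * \<gamma> (x + s *\<^sub>R h))" for x
  have Gm[measurable]: "G \<in> borel_measurable borel"
    unfolding G_def by measurable
  have vh: "integrable lborel (\<lambda>x. indicator (cball 0 r) x * v (h + x))" for r
  proof -
    have [measurable]: "cball (0::'a) r \<in> sets borel" by simp
    have sub: "\<bar>indicator (cball 0 r) x * v (h + x)\<bar> \<le> \<bar>indicator (cball 0 (r + norm h)) (h + x) * v (h + x)\<bar>" for x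
    proof (cases "x \<in> cball 0 r")
      case True
      then have "h + x \<in> cball 0 (r + norm h)" using norm_triangle_ineq[of h x] by auto
      with True show ?thesis by (simp add: indicator_def)
    qed simp
    show ?thesis
    proof (rule Bochner_Integration.integrable_bound[OF integrable_lborel_translate[OF locv[of "r + norm h"], of h]])
      show "(\<lambda>x. indicator (cball 0 r) x * v (h + x)) \<in> borel_measurable lborel" by measurable
    qed (use sub in simp)
  qed
  have Gint: "integrable lborel (\<lambda>x. indicator (cball 0 r) x * G x)" for r
  proof -
    have "integrable (lborel \<Otimes>\<^sub>M lborel) (\<lambda>(x, s). indicator {0..1} s * (indicator (cball 0 r) x * \<gamma> (x + s *\<^sub>R h)))"
    proof (rule line_integrable[OF assms(2) locg _ zero_le_one, where R=r])
      have [measurable]: "cball (0::'a) r \<in> sets borel" by simp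
      show "(\<lambda>(x::'a, s::real). indicator (cball 0 r) x :: real) \<in> borel_measurable (lborel \<Otimes>\<^sub>M lborel)"
        by measurable
    qed simp
    from lborel_pair.integrable_fst'[OF this]
    have "integrable lborel (\<lambda>x. LINT s|lborel. indicator (cball 0 r) x * (indicator {0..1} s * \<gamma> (x + s *\<^sub>R h)))"
      by (simp add: mult.left_commute)
    then show ?thesis by (simp add: G_def)
  qed
  define F where "F x = v (h + x) - v x - G x" for x
  have "AE x in lborel. F x = 0"
  proof (rule AE_zero_of_test_functions)
    show "integrable lborel (\<lambda>x. indicator (cball 0 r) x * F x)" for r
      using vh[of r] locv[of r] Gint[of r] by (simp add: F_def right_diff_distrib)
    show "F \<in> borel_measurable borel" unfolding F_def by measurable
    fix \<psi> :: "'a \<Rightarrow> real" assume tf: "test_function \<psi>"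
    have [measurable]: "\<psi> \<in> borel_measurable borel"
      by (intro borel_measurable_continuous_onI test_function_continuous tf)
    obtain C R where C: "0 \<le> C" "\<And>x. \<bar>\<psi> x\<bar> \<le> C * indicator (cball 0 R) x"
      using test_function_bounds(1)[OF tf] by blast
    define D where "D x = frechet_derivative \<psi> (at x) h" for x
    have Dcont: "continuous_on UNIV D" unfolding D_def by (rule test_function_derivative_continuous[OF tf])
    have [measurable]: "D \<in> borel_measurable borel"
      by (rule borel_measurable_continuous_onI[OF Dcont])
    obtain C' R' where C': "0 \<le> C'" "\<And>x. \<bar>D x\<bar> \<le> C' * indicator (cball 0 R') x"
      using test_function_bounds(2)[OF tf] unfolding D_def by blast
    have i1: "integrable lborel (\<lambda>x. v (h + x) * \<psi> x)" "integrable lborel (\<lambda>x. v x * \<psi> x)"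
      "integrable lborel (\<lambda>x. G x * \<psi> x)"
      by (rule integrable_times_bounded_support[OF _ _ vh C(2)], measurable)
        (rule integrable_times_bounded_support[OF _ _ locv C(2)], measurable,
         rule integrable_times_bounded_support[OF _ _ Gint C(2)], measurable)
    have ih: "integrable lborel (\<lambda>x. v x * \<psi> (x - h))"
      using integrable_lborel_translate[OF i1(1), of "- h"] by simp
    have int1: "integrable (lborel \<Otimes>\<^sub>M lborel) (\<lambda>(x, s). indicator {0..1} s * (\<psi> x * \<gamma> (x + s *\<^sub>R h)))"
      by (rule line_integrable[OF _ locg _ C(1), where R=R]) (use C in auto)
    \<comment> \<open>The trivial shift \<open>s *\<^sub>R 0\<close> brings the integrand into the
      form of \<open>line_integrable\<close>; the dependence on \<open>s\<close> sits in
      \<open>D\<close>, whose support wanders by at most \<open>norm h\<close>.\<close>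
    have int2: "integrable (lborel \<Otimes>\<^sub>M lborel) (\<lambda>(x, s). indicator {0..1} s * (D (x - s *\<^sub>R h) * v (x + s *\<^sub>R 0)))"
    proof (rule line_integrable[OF _ locv _ C'(1), where R="R' + norm h"])
      fix x and s :: real assume s: "s \<in> {0..1}"
      have "norm (s *\<^sub>R h) \<le> norm h" using s by (simp add: mult_left_le_one_le)
      then have "norm x \<le> norm (x - s *\<^sub>R h) + norm h" using norm_triangle_sub[of x "s *\<^sub>R h"] by linarith
      then have "C' * indicator (cball 0 R') (x - s *\<^sub>R h) \<le> C' * indicator (cball 0 (R' + norm h)) x"
        using C' by (auto simp: indicator_def)
      then show "\<bar>D (x - s *\<^sub>R h)\<bar> \<le> C' * indicator (cball 0 (R' + norm h)) x"
        using C'(2)[of "x - s *\<^sub>R h"] by linarith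
    qed measurable
    have shift: "(LINT x|lborel. \<psi> x * \<gamma> (x + s *\<^sub>R h)) = - (LINT x|lborel. D (x - s *\<^sub>R h) * v x)" for s
    proof -
      have "(LINT x|lborel. \<psi> x * \<gamma> (x + s *\<^sub>R h)) = (LINT x|lborel. \<psi> (- s *\<^sub>R h + x) * \<gamma> ((- s *\<^sub>R h + x) + s *\<^sub>R h))"
        by (rule integral_lborel_translate[symmetric]) measurable
      also have "\<dots> = (LINT x|lborel. \<gamma> x * \<psi> (x - s *\<^sub>R h))" by (simp add: mult.commute)
      also have "\<dots> = - (LINT x|lborel. v x * frechet_derivative (\<lambda>x. \<psi> (x - s *\<^sub>R h)) (at x) h)"
        using weak[OF test_function_translate[OF tf]] by simp
      also have "\<dots> = - (LINT x|lborel. D (x - s *\<^sub>R h) * v x)"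
        by (simp add: D_def frechet_derivative_translate(2) test_function_differentiable[OF tf] mult.commute)
      finally show ?thesis .
    qed
    have ftc: "(LINT s|lborel. indicator {0..1} s * D (x - s *\<^sub>R h)) = \<psi> x - \<psi> (x - h)" for x
    proof -
      \<comment> \<open>The path runs in direction \<open>- h\<close>, so the antiderivative carries
        a minus sign.\<close>
      have "(LINT s|lborel. D (x - s *\<^sub>R h) * indicator {0..1} s) = - \<psi> (x - 1 *\<^sub>R h) - (- \<psi> (x - 0 *\<^sub>R h))"
      proof (rule integral_FTC_Icc_real)
        fix s :: real
        have "(\<psi> has_derivative frechet_derivative \<psi> (at (x - s *\<^sub>R h))) (at (x - s *\<^sub>R h))"
          using test_function_differentiable[OF tf] by (simp add: frechet_derivative_works)
        then have "((\<lambda>s. \<psi> (x - s *\<^sub>R h)) has_derivative (\<lambda>z. frechet_derivative \<psi> (at (x - s *\<^sub>R h)) (- (z *\<^sub>R h)))) (at s)"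
          by (rule has_derivative_compose[rotated]) (auto intro!: derivative_eq_intros)
        moreover have "z * - D (x - s *\<^sub>R h) = frechet_derivative \<psi> (at (x - s *\<^sub>R h)) (- (z *\<^sub>R h))" for z
        proof -
          have l: "linear (frechet_derivative \<psi> (at (x - s *\<^sub>R h)))"
            using test_function_differentiable[OF tf] unfolding frechet_derivative_works by (rule has_derivative_linear)
          show ?thesis using linear_neg[OF l] linear_scale[OF l] by (simp add: D_def)
        qed
        ultimately have "((\<lambda>s. \<psi> (x - s *\<^sub>R h)) has_real_derivative - D (x - s *\<^sub>R h)) (at s)"
          by (rule has_derivative_imp_has_field_derivative)
        from DERIV_minus[OF this]
        show "((\<lambda>s. - \<psi> (x - s *\<^sub>R h)) has_real_derivative D (x - s *\<^sub>R h)) (at s)" by simp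
        have "continuous_on UNIV (\<lambda>s. D (x - s *\<^sub>R h))"
          by (auto intro!: continuous_on_compose2[OF Dcont] continuous_intros)
        then show "isCont (\<lambda>s. D (x - s *\<^sub>R h)) s" by (simp add: continuous_on_eq_continuous_at)
      qed simp
      then show ?thesis by (simp add: mult.commute)
    qed
    have "(LINT x|lborel. G x * \<psi> x) = (LINT x|lborel. (LINT s|lborel. indicator {0..1} s * (\<psi> x * \<gamma> (x + s *\<^sub>R h))))"
    proof (rule Bochner_Integration.integral_cong[OF refl])
      fix x
      have "(LINT s|lborel. indicator {0..1} s * (\<psi> x * \<gamma> (x + s *\<^sub>R h))) = (LINT s|lborel. \<psi> x * (indicator {0..1} s * \<gamma> (x + s *\<^sub>R h)))"
        by (simp add: mult.left_commute)
      then show "G x * \<psi> x = (LINT s|lborel. indicator {0..1} s * (\<psi> x * \<gamma> (x + s *\<^sub>R h)))"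
        by (simp add: G_def)
    qed
    also have "\<dots> = (LINT s|lborel. (LINT x|lborel. indicator {0..1} s * (\<psi> x * \<gamma> (x + s *\<^sub>R h))))"
      by (rule lborel_pair.Fubini_integral[OF int1, symmetric])
    also have "\<dots> = (LINT s|lborel. - (LINT x|lborel. indicator {0..1} s * (D (x - s *\<^sub>R h) * v (x + s *\<^sub>R 0))))"
      by (simp add: shift)
    also have "\<dots> = - (LINT s|lborel. (LINT x|lborel. indicator {0..1} s * (D (x - s *\<^sub>R h) * v (x + s *\<^sub>R 0))))"
      by (rule Bochner_Integration.integral_minus)
    also have "\<dots> = - (LINT x|lborel. (LINT s|lborel. indicator {0..1} s * (D (x - s *\<^sub>R h) * v (x + s *\<^sub>R 0))))"
      by (subst lborel_pair.Fubini_integral[OF int2]) simp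
    also have "\<dots> = - (LINT x|lborel. v x * (\<psi> x - \<psi> (x - h)))"
    proof -
      have "(LINT s|lborel. indicator {0..1} s * (D (x - s *\<^sub>R h) * v (x + s *\<^sub>R 0))) = v x * (\<psi> x - \<psi> (x - h))" for x
      proof -
        have "(LINT s|lborel. indicator {0..1} s * (D (x - s *\<^sub>R h) * v (x + s *\<^sub>R 0))) = (LINT s|lborel. v x * (indicator {0..1} s * D (x - s *\<^sub>R h)))"
          by (simp add: mult.commute mult.left_commute)
        then show ?thesis by (simp add: ftc)
      qed
      then show ?thesis by simp
    qed
    also have "\<dots> = (LINT x|lborel. v x * \<psi> (x - h)) - (LINT x|lborel. v x * \<psi> x)"
      using i1(2) ih by (simp add: right_diff_distrib)
    also have "(LINT x|lborel. v x * \<psi> (x - h)) = (LINT x|lborel. v (h + x) * \<psi> (h + x - h))"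
      by (rule integral_lborel_translate[symmetric]) measurable
    finally have "(LINT x|lborel. G x * \<psi> x) = (LINT x|lborel. v (h + x) * \<psi> x) - (LINT x|lborel. v x * \<psi> x)" by simp
    then show "(LINT x|lborel. F x * \<psi> x) = 0"
      using i1 by (simp add: F_def left_diff_distrib)
  qed
  then show ?thesis by (simp add: F_def G_def)
qed

text \<open>The tangent to the p-th power at \<open>m\<close>, rearranged so that no term is
  negative and both sides can be integrated in \<open>ennreal\<close>.\<close>

lemma powr_above_tangent:
  fixes y m p :: real
  assumes "1 \<le> p" "0 \<le> y" "0 \<le> m"
  shows "p * m powr (p - 1) * y \<le> y powr p + (p - 1) * m powr p"
proof -
  consider "m = 0" | "0 < m" "y = 0" | "0 < m" "0 < y" using assms by linarith
  then show ?thesis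
  proof cases
    case 1
    then show ?thesis using assms by (cases "p = 1") auto
  next
    case 2
    then show ?thesis using assms by simp
  next
    case 3
    have "y powr p - m powr p \<ge> (p * m powr (p - 1)) * (y - m)"
      using 3 assms by (intro convex_on_imp_above_tangent[OF powr_convex])
        (auto simp: interior_open intro!: derivative_eq_intros)
    moreover have "p * m powr (p - 1) * m = p * m powr p" using 3 by (simp add: powr_diff)
    ultimately show ?thesis unfolding right_diff_distrib left_diff_distrib by linarith
  qed
qed

text \<open>Jensen's inequality: integrate the tangent at the mean \<open>m\<close> of
  \<open>\<bar>f\<bar>\<close> and cancel the finite term \<open>(p - 1) * m powr p\<close>. If
  \<open>f\<close> is not integrable on the unit interval, the Bochner integral is \<open>0\<close>
  by convention and so is the left side.\<close>

lemma powr_abs_integral_le: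
  fixes f :: "real \<Rightarrow> real"
  assumes [measurable]: "f \<in> borel_measurable borel" and p: "1 \<le> p"
  shows "ennreal (\<bar>LINT s|lborel. indicator {0..1} s * f s\<bar> powr p)
    \<le> (\<integral>\<^sup>+s. ennreal (\<bar>f s\<bar> powr p) * indicator {0..1} s \<partial>lborel)"
proof (cases "integrable lborel (\<lambda>s. indicator {0..1} s * f s)")
  case True
  define m where "m = (LINT s|lborel. \<bar>indicator {0..1} s * f s\<bar>)"
  have m: "0 \<le> m" unfolding m_def by simp
  let ?I = "\<integral>\<^sup>+s. ennreal (\<bar>f s\<bar> powr p) * indicator {0..1} s \<partial>lborel"
  have mm: "m powr (p - 1) * m = m powr p" using m by (cases "m = 0") (auto simp: powr_diff)
  have nm: "(\<integral>\<^sup>+s. ennreal \<bar>indicator {0..1} s * f s\<bar> \<partial>lborel) = ennreal m"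
    unfolding m_def by (rule nn_integral_eq_integral) (use True in auto)
  have "ennreal (p * m powr p) = ennreal (p * m powr (p - 1)) * (\<integral>\<^sup>+s. ennreal \<bar>indicator {0..1} s * f s\<bar> \<partial>lborel)"
    unfolding nm using m p mm by (simp add: ennreal_mult[symmetric] mult.assoc)
  also have "\<dots> = (\<integral>\<^sup>+s. ennreal (p * m powr (p - 1)) * ennreal \<bar>indicator {0..1} s * f s\<bar> \<partial>lborel)"
    by (rule nn_integral_cmult[symmetric]) measurable
  also have "\<dots> \<le> (\<integral>\<^sup>+s. ennreal (\<bar>f s\<bar> powr p) * indicator {0..1} s + ennreal ((p - 1) * m powr p) * indicator {0..1} s \<partial>lborel)"
  proof (rule nn_integral_mono)
    fix s
    have "ennreal (p * m powr (p - 1) * \<bar>f s\<bar>) \<le> ennreal (\<bar>f s\<bar> powr p + (p - 1) * m powr p)"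
      using p m by (intro ennreal_leI powr_above_tangent) auto
    then show "ennreal (p * m powr (p - 1)) * ennreal \<bar>indicator {0..1} s * f s\<bar>
      \<le> ennreal (\<bar>f s\<bar> powr p) * indicator {0..1} s + ennreal ((p - 1) * m powr p) * indicator {0..1} s"
      using p by (auto simp: indicator_def ennreal_mult' ennreal_plus)
  qed
  also have "\<dots> = ?I + ennreal ((p - 1) * m powr p)"
    by (subst nn_integral_add) (auto simp: nn_integral_cmult_indicator)
  finally have le: "ennreal (p * m powr p) \<le> ?I + ennreal ((p - 1) * m powr p)" .
  have "ennreal (m powr p) \<le> ?I"
  proof (cases "?I = \<infinity>")
    case False
    then obtain i where i: "?I = ennreal i" "0 \<le> i" by (cases ?I) auto
    have "ennreal (p * m powr p) \<le> ennreal (i + (p - 1) * m powr p)"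
      using le p i by (simp add: ennreal_plus)
    then have "p * m powr p \<le> i + (p - 1) * m powr p" using i p by (subst (asm) ennreal_le_iff) auto
    then show ?thesis unfolding i(1) by (intro ennreal_leI) (simp add: algebra_simps)
  qed simp
  moreover have "\<bar>LINT s|lborel. indicator {0..1} s * f s\<bar> \<le> m"
    unfolding m_def by (rule integral_abs_bound)
  then have "ennreal (\<bar>LINT s|lborel. indicator {0..1} s * f s\<bar> powr p) \<le> ennreal (m powr p)"
    using p by (intro ennreal_leI powr_mono2) auto
  ultimately show ?thesis by (rule order_trans[rotated])
qed (simp add: not_integrable_integral_eq)

text \<open>After Jensen and Fubini, translation invariance makes the inner integral independent of
  \<open>s\<close>.\<close>

lemma translate_diff_lp_bound:
  fixes v \<gamma> :: "'a::euclidean_space \<Rightarrow> real"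
  assumes [measurable]: "v \<in> borel_measurable borel" "\<gamma> \<in> borel_measurable borel" and p: "1 \<le> p"
    and diff: "AE x in lborel. v (h + x) - v x = (LINT s|lborel. indicator {0..1} s * \<gamma> (x + s *\<^sub>R h))"
  shows "(\<integral>\<^sup>+x. ennreal (\<bar>v (h + x) - v x\<bar> powr p) \<partial>lborel) \<le> (\<integral>\<^sup>+x. ennreal (\<bar>\<gamma> x\<bar> powr p) \<partial>lborel)"
proof -
  let ?I = "\<integral>\<^sup>+x. ennreal (\<bar>\<gamma> x\<bar> powr p) \<partial>lborel"
  have "(\<integral>\<^sup>+x. ennreal (\<bar>v (h + x) - v x\<bar> powr p) \<partial>lborel)
      \<le> (\<integral>\<^sup>+x. (\<integral>\<^sup>+s. ennreal (\<bar>\<gamma> (x + s *\<^sub>R h)\<bar> powr p) * indicator {0..1} s \<partial>lborel) \<partial>lborel)"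
  proof (rule nn_integral_mono_AE)
    show "AE x in lborel. ennreal (\<bar>v (h + x) - v x\<bar> powr p)
        \<le> (\<integral>\<^sup>+s. ennreal (\<bar>\<gamma> (x + s *\<^sub>R h)\<bar> powr p) * indicator {0..1} s \<partial>lborel)"
      using diff
    proof eventually_elim
      case (elim x)
      show ?case unfolding elim by (rule powr_abs_integral_le[OF _ p]) measurable
    qed
  qed
  also have "\<dots> = (\<integral>\<^sup>+s. (\<integral>\<^sup>+x. ennreal (\<bar>\<gamma> (x + s *\<^sub>R h)\<bar> powr p) * indicator {0..1} s \<partial>lborel) \<partial>lborel)"
    by (rule lborel_pair.Fubini'[symmetric]) measurable
  also have "\<dots> = (\<integral>\<^sup>+s. ?I * indicator {0..1::real} s \<partial>lborel)"
  proof (rule nn_integral_cong)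
    fix s :: real
    have "(\<integral>\<^sup>+x. ennreal (\<bar>\<gamma> (s *\<^sub>R h + x)\<bar> powr p) \<partial>lborel) = ?I"
      by (rule nn_integral_lborel_translate) measurable
    then show "(\<integral>\<^sup>+x. ennreal (\<bar>\<gamma> (x + s *\<^sub>R h)\<bar> powr p) * indicator {0..1} s \<partial>lborel) = ?I * indicator {0..1} s"
      by (subst nn_integral_multc) (simp_all add: add.commute)
  qed
  also have "\<dots> = ?I" by (simp add: nn_integral_cmult_indicator)
  finally show ?thesis .
qed

subsection \<open>The energy of Sobolev functions\<close>

lemma locally_integrable_cball:
  assumes "locally_integrable g"
  shows "integrable lebesgue (\<lambda>x. indicator (cball 0 r) x *\<^sub>R g x)"
  using assms unfolding locally_integrable_def set_integrable_def by simp

lemma locally_integrable_measurable: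
  fixes g :: "'a::euclidean_space \<Rightarrow> 'b::euclidean_space"
  assumes "locally_integrable g"
  shows "g \<in> borel_measurable lebesgue"
proof (rule borel_measurable_LIMSEQ_metric)
  show "(\<lambda>x. indicator (cball 0 (real n)) x *\<^sub>R g x) \<in> borel_measurable lebesgue" for n
    using locally_integrable_cball[OF assms] by (rule borel_measurable_integrable)
  show "(\<lambda>n. indicator (cball 0 (real n)) x *\<^sub>R g x) \<longlonglongrightarrow> g x" for x
  proof (rule tendsto_eventually)
    obtain N where "norm x \<le> real N" using real_arch_simple by blast
    then show "\<forall>\<^sub>F n in sequentially. indicator (cball 0 (real n)) x *\<^sub>R g x = g x"
      by (intro eventually_sequentiallyI[of N]) (auto simp: indicator_def)
  qed
qed

lemma integrable_lebesgue_borel_version: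
  fixes f f' :: "'a::euclidean_space \<Rightarrow> real"
  assumes f: "integrable lebesgue f" and f': "f' \<in> borel_measurable borel" and ae: "AE x in lborel. f x = f' x"
  shows "integrable lborel f'"
proof -
  have m: "f' \<in> borel_measurable lebesgue" using f' by (intro measurable_completion) simp
  have "integrable lebesgue f'"
    using f by (rule integrable_cong_AE_imp[OF _ m]) (use ae in \<open>auto simp: AE_completion_iff\<close>)
  then show ?thesis using f' by (subst (asm) integrable_completion) auto
qed

lemma integral_lebesgue_borel_version:
  fixes f f' :: "'a::euclidean_space \<Rightarrow> real"
  assumes f: "f \<in> borel_measurable lebesgue" and f': "f' \<in> borel_measurable borel" and ae: "AE x in lborel. f x = f' x"
  shows "(LINT x|lebesgue. f x) = (LINT x|lborel. f' x)"
proof -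
  have m: "f' \<in> borel_measurable lebesgue" using f' by (intro measurable_completion) simp
  have "(LINT x|lebesgue. f x) = (LINT x|lebesgue. f' x)"
    using ae by (intro integral_cong_AE f m) (simp add: AE_completion_iff)
  also have "\<dots> = (LINT x|lborel. f' x)" using f' by (intro integral_completion) simp
  finally show ?thesis .
qed

text \<open>The gradient is replaced by Borel representatives of its coordinates. The weak identity
  for basis vectors extends by linearity to the direction \<open>h\<close>, and Cauchy-Schwarz for
  \<open>h \<bullet> g x\<close> produces the factor \<open>norm h powr p\<close>.\<close>

lemma weak_gradient_translate_bound:
  fixes u v :: "'a::euclidean_space \<Rightarrow> real"
  assumes wg: "has_weak_gradient u g" and p: "1 \<le> p"
    and v[measurable]: "v \<in> borel_measurable borel" and uv: "AE x in lborel. u x = v x"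
  shows "(\<integral>\<^sup>+x. ennreal (\<bar>v (h + x) - v x\<bar> powr p) \<partial>lborel) \<le> ennreal (norm h powr p) * lp_energy p g"
proof -
  have lu: "locally_integrable u" and lg: "locally_integrable g" using wg by (auto simp: has_weak_gradient_def)
  have um: "u \<in> borel_measurable lebesgue" and gm: "g \<in> borel_measurable lebesgue"
    using lu lg by (auto intro: locally_integrable_measurable)
  have "\<exists>\<gamma>. \<gamma> \<in> borel_measurable borel \<and> (AE x in lborel. g x \<bullet> b = \<gamma> x)" for b
  proof -
    have "(\<lambda>x. g x \<bullet> b) \<in> borel_measurable lebesgue" using gm by measurable
    from completion_ex_borel_measurable_real[OF this] show ?thesis by auto
  qed
  then obtain \<gamma> where gb[measurable]: "\<And>b. \<gamma> b \<in> borel_measurable borel"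
    and gae: "\<And>b. AE x in lborel. g x \<bullet> b = \<gamma> b x" by metis
  define \<gamma>h where "\<gamma>h x = (\<Sum>b\<in>Basis. (h \<bullet> b) * \<gamma> b x)" for x
  have gh[measurable]: "\<gamma>h \<in> borel_measurable borel" unfolding \<gamma>h_def by measurable
  have [measurable]: "cball (0::'a) r \<in> sets borel" for r by simp
  have locv: "integrable lborel (\<lambda>x. indicator (cball 0 r) x * v x)" for r
    using uv by (intro integrable_lebesgue_borel_version[OF locally_integrable_cball[OF lu, of r]]) auto
  have locb: "integrable lborel (\<lambda>x. indicator (cball 0 r) x * \<gamma> b x)" for r b
    using gae[of b]
    by (intro integrable_lebesgue_borel_version[OF integrable_inner_left[OF locally_integrable_cball[OF lg, of r], of b]]) auto
  have locg: "integrable lborel (\<lambda>x. indicator (cball 0 r) x * \<gamma>h x)" for r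
  proof -
    have "integrable lborel (\<lambda>x. \<Sum>b\<in>Basis. (h \<bullet> b) * (indicator (cball 0 r) x * \<gamma> b x))"
      by (intro Bochner_Integration.integrable_sum integrable_mult_right locb)
    then show ?thesis by (simp add: \<gamma>h_def sum_distrib_left mult.left_commute)
  qed
  have weak: "(LINT x|lborel. v x * frechet_derivative \<psi> (at x) h) = - (LINT x|lborel. \<gamma>h x * \<psi> x)"
    if tf: "test_function \<psi>" for \<psi>
  proof -
    have pm[measurable]: "\<psi> \<in> borel_measurable borel"
      by (intro borel_measurable_continuous_onI test_function_continuous tf)
    have dm[measurable]: "(\<lambda>x. frechet_derivative \<psi> (at x) b) \<in> borel_measurable borel" for b
      by (intro borel_measurable_continuous_onI test_function_derivative_continuous tf)
    have pml: "\<psi> \<in> borel_measurable lebesgue" "(\<lambda>x. frechet_derivative \<psi> (at x) b) \<in> borel_measurable lebesgue" for b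
      by (intro measurable_completion; simp)+
    obtain C R where C: "\<And>x. \<bar>\<psi> x\<bar> \<le> C * indicator (cball 0 R) x"
      using test_function_bounds(1)[OF tf] by blast
    have i1: "integrable lborel (\<lambda>x. \<gamma> b x * \<psi> x)" for b
      by (rule integrable_times_bounded_support[OF _ _ locb C]) measurable
    have i2: "integrable lborel (\<lambda>x. v x * frechet_derivative \<psi> (at x) b)" for b
    proof -
      obtain C' R' where C': "\<And>x. \<bar>frechet_derivative \<psi> (at x) b\<bar> \<le> C' * indicator (cball 0 R') x"
        using test_function_bounds(2)[OF tf] by blast
      show ?thesis by (rule integrable_times_bounded_support[OF _ _ locv C']) measurable
    qed
    have eq: "(LINT x|lborel. v x * frechet_derivative \<psi> (at x) b) = - (LINT x|lborel. \<gamma> b x * \<psi> x)" if b: "b \<in> Basis" for b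
    proof -
      have "(LINT x|lborel. v x * frechet_derivative \<psi> (at x) b) = (LINT x|lebesgue. u x * frechet_derivative \<psi> (at x) b)"
        using uv um pml by (intro integral_lebesgue_borel_version[symmetric]) auto
      also have "\<dots> = - (LINT x|lebesgue. (g x \<bullet> b) * \<psi> x)"
        using wg tf b by (auto simp: has_weak_gradient_def)
      also have "(LINT x|lebesgue. (g x \<bullet> b) * \<psi> x) = (LINT x|lborel. \<gamma> b x * \<psi> x)"
        using gae[of b] gm pml by (intro integral_lebesgue_borel_version) auto
      finally show ?thesis .
    qed
    have "(LINT x|lborel. v x * frechet_derivative \<psi> (at x) h) = (LINT x|lborel. (\<Sum>b\<in>Basis. (h \<bullet> b) * (v x * frechet_derivative \<psi> (at x) b)))"
      by (subst frechet_derivative_expand[OF test_function_differentiable[OF tf]])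
        (simp add: sum_distrib_left mult.left_commute)
    also have "\<dots> = (\<Sum>b\<in>Basis. (h \<bullet> b) * (LINT x|lborel. v x * frechet_derivative \<psi> (at x) b))"
      by (subst Bochner_Integration.integral_sum) (auto intro!: i2)
    also have "\<dots> = - (\<Sum>b\<in>Basis. (h \<bullet> b) * (LINT x|lborel. \<gamma> b x * \<psi> x))"
      by (simp add: eq sum_negf)
    also have "(\<Sum>b\<in>Basis. (h \<bullet> b) * (LINT x|lborel. \<gamma> b x * \<psi> x)) = (LINT x|lborel. (\<Sum>b\<in>Basis. (h \<bullet> b) * (\<gamma> b x * \<psi> x)))"
      by (subst Bochner_Integration.integral_sum) (auto intro!: i1)
    also have "\<dots> = (LINT x|lborel. \<gamma>h x * \<psi> x)" by (simp add: \<gamma>h_def sum_distrib_right mult.assoc)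
    finally show ?thesis .
  qed
  have "(\<integral>\<^sup>+x. ennreal (\<bar>v (h + x) - v x\<bar> powr p) \<partial>lborel) \<le> (\<integral>\<^sup>+x. ennreal (\<bar>\<gamma>h x\<bar> powr p) \<partial>lborel)"
    by (rule translate_diff_lp_bound[OF v gh p translate_diff_eq_line_integral[OF v gh locv locg weak]])
  also have "\<dots> \<le> (\<integral>\<^sup>+x. ennreal (norm h powr p) * ennreal (norm (g x) powr p) \<partial>lborel)"
  proof (rule nn_integral_mono_AE)
    have "AE x in lborel. \<forall>b\<in>Basis. g x \<bullet> b = \<gamma> b x"
      using gae by (simp add: AE_finite_all)
    then show "AE x in lborel. ennreal (\<bar>\<gamma>h x\<bar> powr p) \<le> ennreal (norm h powr p) * ennreal (norm (g x) powr p)"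
    proof eventually_elim
      case (elim x)
      have "\<gamma>h x = h \<bullet> g x" unfolding \<gamma>h_def euclidean_inner[of h "g x"] using elim by simp
      then have "\<bar>\<gamma>h x\<bar> powr p \<le> (norm h * norm (g x)) powr p"
        using p Cauchy_Schwarz_ineq2[of h "g x"] by (intro powr_mono2) auto
      then show ?case by (simp add: powr_mult ennreal_mult[symmetric] ennreal_leI)
    qed
  qed
  also have "\<dots> = (\<integral>\<^sup>+x. ennreal (norm h powr p) * ennreal (norm (g x) powr p) \<partial>lebesgue)"
    by (rule nn_integral_completion[symmetric])
  also have "\<dots> = ennreal (norm h powr p) * lp_energy p g"
    unfolding lp_energy_def using gm by (intro nn_integral_cmult) measurable
  finally show ?thesis .
qed

lemma powr_abs_diff_le:
  fixes a b :: real
  assumes "1 \<le> p"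
  shows "\<bar>a - b\<bar> powr p \<le> 2 powr p * (\<bar>a\<bar> powr p + \<bar>b\<bar> powr p)"
proof -
  have "\<bar>a - b\<bar> powr p \<le> (2 * max \<bar>a\<bar> \<bar>b\<bar>) powr p"
    using assms by (intro powr_mono2) auto
  also have "\<dots> = 2 powr p * max \<bar>a\<bar> \<bar>b\<bar> powr p" by (simp add: powr_mult)
  also have "\<dots> \<le> 2 powr p * (\<bar>a\<bar> powr p + \<bar>b\<bar> powr p)"
    by (intro mult_left_mono) (auto simp: max_def)
  finally show ?thesis .
qed

text \<open>Substituting \<open>y = x - h\<close> turns the inner integral into the
  \<open>L^p\<close> size of a difference of translates. The gradient bounds it for
  \<open>norm h \<le> 1\<close>, the function itself for \<open>norm h > 1\<close>; together they
  produce the weight \<open>min 1 (norm h powr p)\<close>. In \<open>2 powr (p + 1)\<close>, the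
  factor \<open>2 powr p\<close> is from \<open>powr_abs_diff_le\<close> and the last
  \<open>2\<close> from the two translates of equal size.\<close>

lemma sobolev_energy_bound:
  fixes u :: "'a::euclidean_space \<Rightarrow> real"
  assumes levy: "levy_kernel p \<nu>" and p: "1 \<le> p"
    and u: "u \<in> borel_measurable lebesgue" and wg: "has_weak_gradient u g"
  shows "nonlocal_energy p \<nu> u \<le> ennreal (2 powr (p + 1)) * (lp_energy p u + lp_energy p g) *
    (\<integral>\<^sup>+h. ennreal (min 1 (norm h powr p) * \<nu> h) \<partial>lebesgue)"
proof -
  obtain f :: "'a \<Rightarrow> ennreal" where f[measurable]: "f \<in> borel_measurable borel"
    and fnu: "AE h in lborel. f h = ennreal (\<nu> h)"
    using levy_kernel_borel_version[OF levy] by blast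
  obtain v where v[measurable]: "v \<in> borel_measurable borel" and uv: "AE x in lborel. u x = v x"
    using completion_ex_borel_measurable_real[OF u] by auto
  define S where "S = lp_energy p u + lp_energy p g"
  have Uv: "lp_energy p u = (\<integral>\<^sup>+x. ennreal (\<bar>v x\<bar> powr p) \<partial>lborel)"
    unfolding lp_energy_def nn_integral_completion using uv by (intro nn_integral_cong_AE) auto
  have shift: "(\<integral>\<^sup>+x. ennreal (\<bar>v x - v (x - h)\<bar> powr p) \<partial>lborel) \<le> ennreal (2 powr (p + 1) * min 1 (norm h powr p)) * S" for h
  proof -
    have eq: "(\<integral>\<^sup>+x. ennreal (\<bar>v x - v (x - h)\<bar> powr p) \<partial>lborel) = (\<integral>\<^sup>+x. ennreal (\<bar>v (- h + x) - v x\<bar> powr p) \<partial>lborel)"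
      by (simp add: abs_minus_commute)
    show ?thesis
    proof (cases "norm h \<le> 1")
      case True
      have "norm h powr p \<le> 1" using True p powr_le1 by simp
      then have "ennreal (norm h powr p) \<le> ennreal (2 powr (p + 1) * min 1 (norm h powr p))"
        using p mult_right_mono[of 1 "2 powr (p + 1)" "norm h powr p"] by (intro ennreal_leI) (simp add: min_def ge_one_powr_ge_zero)
      then have "ennreal (norm (- h) powr p) * lp_energy p g \<le> ennreal (2 powr (p + 1) * min 1 (norm h powr p)) * S"
        by (intro mult_mono) (auto simp: S_def)
      with weak_gradient_translate_bound[OF wg p v uv, of "- h"] show ?thesis
        unfolding eq by (rule order_trans)
    next
      case False
      then have "1 \<le> norm h powr p" using p by (intro ge_one_powr_ge_zero) auto
      then have m: "min 1 (norm h powr p) = 1" by simp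
      have "(\<integral>\<^sup>+x. ennreal (\<bar>v (- h + x) - v x\<bar> powr p) \<partial>lborel)
          \<le> (\<integral>\<^sup>+x. ennreal (2 powr p) * (ennreal (\<bar>v (- h + x)\<bar> powr p) + ennreal (\<bar>v x\<bar> powr p)) \<partial>lborel)"
        using powr_abs_diff_le[OF p] by (intro nn_integral_mono) (auto simp: ennreal_mult[symmetric] ennreal_plus[symmetric] simp del: ennreal_plus intro!: ennreal_leI)
      also have "\<dots> = ennreal (2 powr p) * ((\<integral>\<^sup>+x. ennreal (\<bar>v (- h + x)\<bar> powr p) \<partial>lborel) + (\<integral>\<^sup>+x. ennreal (\<bar>v x\<bar> powr p) \<partial>lborel))"
        by (simp add: nn_integral_cmult nn_integral_add)
      also have "(\<integral>\<^sup>+x. ennreal (\<bar>v (- h + x)\<bar> powr p) \<partial>lborel) = (\<integral>\<^sup>+x. ennreal (\<bar>v x\<bar> powr p) \<partial>lborel)"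
        by (rule nn_integral_lborel_translate) measurable
      also have "ennreal (2 powr p) * ((\<integral>\<^sup>+x. ennreal (\<bar>v x\<bar> powr p) \<partial>lborel) + (\<integral>\<^sup>+x. ennreal (\<bar>v x\<bar> powr p) \<partial>lborel))
          = ennreal (2 powr p) * 2 * lp_energy p u" by (simp add: Uv mult_2[symmetric] mult.assoc)
      also have "ennreal (2 powr p) * 2 = ennreal (2 powr (p + 1))"
        by (simp add: powr_add ennreal_mult)
      also have "ennreal (2 powr (p + 1)) * lp_energy p u \<le> ennreal (2 powr (p + 1)) * S"
        by (intro mult_left_mono) (auto simp: S_def)
      finally show ?thesis unfolding eq m by simp
    qed
  qed
  have mm: "(\<lambda>h::'a. ennreal (2 powr (p + 1) * min 1 (norm h powr p)) * f h) \<in> borel_measurable lborel" by measurable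
  have "nonlocal_energy p \<nu> u = (\<integral>\<^sup>+x. (\<integral>\<^sup>+y. ennreal (\<bar>v x - v y\<bar> powr p) * f (x - y) \<partial>lborel) \<partial>lborel)"
    by (rule nonlocal_energy_borel_version[OF fnu uv])
  also have "\<dots> = (\<integral>\<^sup>+x. (\<integral>\<^sup>+h. ennreal (\<bar>v x - v (x - h)\<bar> powr p) * f (x - (x - h)) \<partial>lborel) \<partial>lborel)"
    by (intro nn_integral_cong nn_integral_lborel_reflect[symmetric]) measurable
  also have "\<dots> = (\<integral>\<^sup>+x. (\<integral>\<^sup>+h. ennreal (\<bar>v x - v (x - h)\<bar> powr p) * f h \<partial>lborel) \<partial>lborel)" by simp
  also have "\<dots> = (\<integral>\<^sup>+h. (\<integral>\<^sup>+x. ennreal (\<bar>v x - v (x - h)\<bar> powr p) * f h \<partial>lborel) \<partial>lborel)"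
    by (rule lborel_pair.Fubini'[symmetric]) measurable
  also have "\<dots> = (\<integral>\<^sup>+h. (\<integral>\<^sup>+x. ennreal (\<bar>v x - v (x - h)\<bar> powr p) \<partial>lborel) * f h \<partial>lborel)"
    by (intro nn_integral_cong nn_integral_multc) measurable
  also have "\<dots> \<le> (\<integral>\<^sup>+h. (ennreal (2 powr (p + 1) * min 1 (norm h powr p)) * S) * f h \<partial>lborel)"
    by (intro nn_integral_mono mult_right_mono shift) simp
  also have "\<dots> = (\<integral>\<^sup>+h. S * (ennreal (2 powr (p + 1) * min 1 (norm h powr p)) * f h) \<partial>lborel)"
    by (simp add: mult_ac)
  also have "\<dots> = S * (\<integral>\<^sup>+h. ennreal (2 powr (p + 1)) * (ennreal (min 1 (norm h powr p)) * f h) \<partial>lborel)"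
    by (subst nn_integral_cmult[OF mm]) (simp add: ennreal_mult mult.assoc)
  also have "\<dots> = S * (ennreal (2 powr (p + 1)) * (\<integral>\<^sup>+h. ennreal (min 1 (norm h powr p)) * f h \<partial>lborel))"
    by (subst nn_integral_cmult) measurable
  also have "(\<integral>\<^sup>+h. ennreal (min 1 (norm h powr p)) * f h \<partial>lborel) = (\<integral>\<^sup>+h. ennreal (min 1 (norm h powr p) * \<nu> h) \<partial>lebesgue)"
    unfolding nn_integral_completion using fnu by (intro nn_integral_cong_AE) (auto simp: ennreal_mult')
  finally show ?thesis by (simp add: S_def mult_ac)
qed

lemma ennreal_powr_cmult_le:
  assumes "0 < c" "0 < a"
  shows "ennreal_powr (ennreal c * x) a \<le> ennreal (c powr a) * ennreal_powr x a"
proof (cases x)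
  case (real r)
  then show ?thesis using assms
    by (simp add: ennreal_powr_def ennreal_mult[symmetric] powr_mult)
next
  case top
  then show ?thesis using assms by (simp add: ennreal_powr_def ennreal_mult_top)
qed

section \<open>The classical Sobolev embedding\<close>

context potential_setting
begin

lemma sobolev_embedding:
  "continuously_embedded (sobolev_space p :: ('a \<Rightarrow> real) set) (sobolev_norm p)
    (orlicz_space (extend_infty \<phi>)) (luxemburg_norm (extend_infty \<phi>))"
proof -
  define L where "L = enn2real (\<integral>\<^sup>+h. ennreal (min 1 (norm h powr p) * \<nu> h) \<partial>lebesgue)"
  have L: "(\<integral>\<^sup>+h. ennreal (min 1 (norm h powr p) * \<nu> h) \<partial>lebesgue) = ennreal L" "0 \<le> L"
    using levy by (auto simp: levy_kernel_def L_def less_top)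
  \<comment> \<open>The summand \<open>1\<close> makes the embedding constant positive from
    \<open>L \<ge> 0\<close> alone.\<close>
  define c where "c = 2 powr (p + 1) * L + 1"
  have c: "0 < c" using L by (simp add: c_def add_nonneg_pos)
  have bound: "nonlocal_energy p \<nu> u \<le> ennreal c * (lp_energy p u + lp_energy p g)"
    if "u \<in> borel_measurable lebesgue" "has_weak_gradient u g" for u g
  proof -
    have "nonlocal_energy p \<nu> u \<le> ennreal (2 powr (p + 1)) * (lp_energy p u + lp_energy p g) * ennreal L"
      using sobolev_energy_bound[OF levy p that] by (simp add: L)
    also have "\<dots> = ennreal (2 powr (p + 1) * L) * (lp_energy p u + lp_energy p g)"
      using L by (simp add: ennreal_mult mult_ac)
    also have "\<dots> \<le> ennreal c * (lp_energy p u + lp_energy p g)"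
      by (intro mult_right_mono ennreal_leI) (auto simp: c_def)
    finally show ?thesis .
  qed
  show ?thesis
  proof (rule embedding_of_energy_bound[of _ "c powr (1 / p)"])
    show "(sobolev_space p :: ('a \<Rightarrow> real) set) \<subseteq> lp_space p" by (auto simp: sobolev_space_def)
    show "0 < c powr (1 / p)" using c by simp
    fix u :: "'a \<Rightarrow> real" assume u: "u \<in> sobolev_space p"
    then obtain g where g: "g \<in> lp_space p" "has_weak_gradient u g" by (auto simp: sobolev_space_def)
    have um: "u \<in> borel_measurable lebesgue" and U: "lp_energy p u < \<infinity>"
      using u by (auto simp: sobolev_space_def lp_space_def)
    show "nonlocal_energy p \<nu> u < \<infinity>"
      using bound[OF um g(2)] U g(1) by (auto simp: lp_space_def ennreal_mult_less_top intro: le_less_trans)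
    \<comment> \<open>Finiteness of the energy was read off from the gradient \<open>g\<close> in
      \<open>L^p\<close>; the norm refers to the selected gradient. As \<open>bound\<close> holds
      for every weak gradient, it is now applied to the selected one.\<close>
    have "has_weak_gradient u (weak_gradient u)"
      unfolding weak_gradient_def by (rule someI[of "has_weak_gradient u"]) (rule g(2))
    from bound[OF um this]
    have "ennreal_powr (nonlocal_energy p \<nu> u) (1 / p) \<le> ennreal_powr (ennreal c * (lp_energy p u + lp_energy p (weak_gradient u))) (1 / p)"
      using p by (intro ennreal_powr_mono) auto
    also have "\<dots> \<le> ennreal (c powr (1 / p)) * sobolev_norm p u"
      unfolding sobolev_norm_def using c p by (intro ennreal_powr_cmult_le) auto
    finally show "ennreal_powr (nonlocal_energy p \<nu> u) (1 / p) \<le> ennreal (c powr (1 / p)) * sobolev_norm p u" .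
  qed
qed

end

theorem theorem1p1:
  fixes p \<kappa> \<theta> :: real
    and \<nu> :: "'a::euclidean_space \<Rightarrow> real"
    and \<phi> :: "real \<Rightarrow> real"
  assumes p: "1 \<le> p"
    and levy: "levy_kernel p \<nu>"
    and rad: "radial \<nu>"
    and kappa: "0 < \<kappa>" "\<kappa> \<le> 1"
    and almost_dec: "almost_decreasing \<kappa> \<nu>"
    and bij: "bij_betw (recip_potential p \<nu>) {0..} {0..}"
    and inverse: "\<And>s. 0 \<le> s \<Longrightarrow> \<phi> s = the_inv_into {0..} (recip_potential p \<nu>) s"
    and young: "young_function (extend_infty \<phi>)"
    and convex_p: "convex_on {0..} (\<lambda>s. \<phi> (s powr (1 / p)))"
    and theta: "0 < \<theta>"
    and growth: "\<And>s t. 0 \<le> s \<Longrightarrow> s \<le> t \<Longrightarrow> 0 < t \<Longrightarrow> \<phi> (\<theta> * (s / t)) \<le> \<phi> s / \<phi> t"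
  shows "(\<forall>t. 2 \<le> t \<and> (p = 1 \<longrightarrow> 2 < t) \<longrightarrow>
            (\<forall>u \<in> orlicz_space (extend_infty \<phi>).
               luxemburg_norm (extend_infty \<phi>) u \<le>
               ennreal (Theta_const p \<kappa> \<theta> \<phi> t) * ennreal_powr (nonlocal_energy p \<nu> u) (1 / p))) \<and>
         continuously_embedded (nonlocal_sobolev_space p \<nu>) (nonlocal_sobolev_norm p \<nu>)
           (orlicz_space (extend_infty \<phi>)) (luxemburg_norm (extend_infty \<phi>)) \<and>
         continuously_embedded (sobolev_space p :: ('a \<Rightarrow> real) set) (sobolev_norm p)
           (orlicz_space (extend_infty \<phi>)) (luxemburg_norm (extend_infty \<phi>))"
proof -
  interpret potential_setting p \<kappa> \<theta> \<nu> \<phi>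
    by unfold_locales (rule p levy kappa almost_dec bij inverse convex_p theta growth; assumption)+
  show ?thesis
    using luxemburg_le_energy_orlicz nonlocal_sobolev_embedding sobolev_embedding by blast
qed

end
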